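(* There is a Lipschitz function $\varphi:\mathbb{R}^2\to\mathbb{R}$ with compact support such that, for every $1\le p<\infty$, the bounded operator $$\Phi:W^{1,p}([0,1],\mathbb{R}^2)\to W^{1,p}([0,1]),\qquad \Phi(u)=\varphi\circ u,$$ is not continuous. (The function $\varphi$ is the same for all $p$.)
   Context: $W^{1,p}([0,1],\mathbb{R}^2)$ is the Sobolev space of $L^p$ mappings with weak derivative in $L^p$, with norm $\|u\|_{1,p}=\|u\|_p+\|u'\|_p$; $W^{1,p}([0,1])$ is the space of real-valued such functions with the same norm. A (possibly nonlinear) operator is called bounded if it maps bounded sets to bounded sets. Continuity is with respect to the norms $\|\cdot\|_{1,p}$. *)

theory Defs
  imports "HOL-Analysis.Analysis"
begin

text \<open>
  Elements of $L^p$ and $W^{1,p}$ are represented by functions on the reals of which only the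
  restriction to the unit interval matters; the usual quotient by almost everywhere equality is
  not formed. Accordingly \<open>Lp_norm\<close> and \<open>sobolev_norm\<close> are, on their respective spaces,
  seminorms that vanish exactly on the functions equal to 0 almost everywhere on the unit interval;
  outside these spaces their values carry no meaning.
\<close>

abbreviation unit_interval_measure :: "real measure" where
  "unit_interval_measure \<equiv> lebesgue_on {0..1}"

definition Lp_space :: "real \<Rightarrow> (real \<Rightarrow> 'a::euclidean_space) set" where
  "Lp_space p = {u. u \<in> borel_measurable unit_interval_measure \<and>
     integrable unit_interval_measure (\<lambda>x. norm (u x) powr p)}"

definition Lp_norm :: "real \<Rightarrow> (real \<Rightarrow> 'a::euclidean_space) \<Rightarrow> real" where
  "Lp_norm p u = (LINT x|unit_interval_measure. norm (u x) powr p) powr (1 / p)"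

definition test_function :: "(real \<Rightarrow> real) \<Rightarrow> bool" where
  "test_function \<psi> \<longleftrightarrow>
     (\<forall>n x. (deriv ^^ n) \<psi> field_differentiable at x) \<and>
     compact (closure {x. \<psi> x \<noteq> 0}) \<and> closure {x. \<psi> x \<noteq> 0} \<subseteq> {0<..<1}"

definition locally_integrable :: "(real \<Rightarrow> 'a::euclidean_space) \<Rightarrow> bool" where
  "locally_integrable u \<longleftrightarrow>
     (\<forall>K. compact K \<and> K \<subseteq> {0<..<1} \<longrightarrow> integrable (lebesgue_on K) u)"

definition has_weak_deriv ::
    "(real \<Rightarrow> 'a::euclidean_space) \<Rightarrow> (real \<Rightarrow> 'a) \<Rightarrow> bool" where
  "has_weak_deriv u v \<longleftrightarrow> locally_integrable u \<and> locally_integrable v \<and>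
     (\<forall>\<psi>. test_function \<psi> \<longrightarrow>
        (LINT x|unit_interval_measure. deriv \<psi> x *\<^sub>R u x) =
        - (LINT x|unit_interval_measure. \<psi> x *\<^sub>R v x))"

text \<open>A weak derivative is unique up to a null set, so the choice does not affect its norm.\<close>

definition weak_deriv :: "(real \<Rightarrow> 'a::euclidean_space) \<Rightarrow> real \<Rightarrow> 'a" where
  "weak_deriv u = (SOME v. has_weak_deriv u v)"

definition sobolev_space :: "real \<Rightarrow> (real \<Rightarrow> 'a::euclidean_space) set" where
  "sobolev_space p = {u \<in> Lp_space p. \<exists>v \<in> Lp_space p. has_weak_deriv u v}"

definition sobolev_norm :: "real \<Rightarrow> (real \<Rightarrow> 'a::euclidean_space) \<Rightarrow> real" where
  "sobolev_norm p u = Lp_norm p u + Lp_norm p (weak_deriv u)"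

text \<open>The second conjunct says that the operator descends to almost everywhere classes.\<close>

definition sobolev_operator ::
    "real \<Rightarrow> ((real \<Rightarrow> 'a::euclidean_space) \<Rightarrow> (real \<Rightarrow> 'b::euclidean_space)) \<Rightarrow> bool" where
  "sobolev_operator p T \<longleftrightarrow>
     (\<forall>u \<in> sobolev_space p. T u \<in> sobolev_space p) \<and>
     (\<forall>u \<in> sobolev_space p. \<forall>v \<in> sobolev_space p.
        (AE x in unit_interval_measure. u x = v x) \<longrightarrow>
        (AE x in unit_interval_measure. T u x = T v x))"

definition sobolev_bounded_operator ::
    "real \<Rightarrow> ((real \<Rightarrow> 'a::euclidean_space) \<Rightarrow> (real \<Rightarrow> 'b::euclidean_space)) \<Rightarrow> bool" where
  "sobolev_bounded_operator p T \<longleftrightarrow> sobolev_operator p T \<and>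
     (\<forall>A \<subseteq> sobolev_space p. bdd_above (sobolev_norm p ` A) \<longrightarrow>
        bdd_above (sobolev_norm p ` T ` A))"

definition sobolev_continuous_operator ::
    "real \<Rightarrow> ((real \<Rightarrow> 'a::euclidean_space) \<Rightarrow> (real \<Rightarrow> 'b::euclidean_space)) \<Rightarrow> bool" where
  "sobolev_continuous_operator p T \<longleftrightarrow>
     (\<forall>u \<in> sobolev_space p. \<forall>\<epsilon>>0. \<exists>\<delta>>0. \<forall>v \<in> sobolev_space p.
        sobolev_norm p (\<lambda>x. v x - u x) < \<delta> \<longrightarrow>
        sobolev_norm p (\<lambda>x. T v x - T u x) < \<epsilon>)"

end

theory Submission
  imports Defs
begin

text \<open>
  The function is \<open>\<phi> y = infdist y Z\<close>, where \<open>Z\<close> consists of the complement of the open box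
  \<open>(-1,2) \<times> (0,2)\<close> and, on each horizontal line at height \<open>2\<^sup>-\<^sup>n\<close>, the points with spacing \<open>2\<^sup>-\<^sup>n\<close>.
  As a distance function it is 1-Lipschitz, and it vanishes outside the box.

  \<^emph>\<open>Discontinuity.\<close> The curves \<open>u\<^sub>n(x) = (x, 2\<^sup>-\<^sup>n)\<close> converge to \<open>u(x) = (x, 0)\<close> in every \<open>W\<^sup>1\<^sup>,\<^sup>p\<close>,
  because they differ from it by constants that tend to 0. Now \<open>\<phi> \<circ> u = 0\<close>, whereas \<open>\<phi> \<circ> u\<^sub>n\<close> is a sawtooth with
  \<open>2\<^sup>n\<close> teeth of height at least \<open>2\<^sup>-\<^sup>n / 2\<close>: the points of \<open>Z\<close> on the line itself force the zeros, and
  the other parts of \<open>Z\<close> are too far away to flatten the teeth. The total variation, hence the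
  \<open>L\<^sup>1\<close> norm of the weak derivative, stays at least 1/2, and so does the \<open>L\<^sup>p\<close> norm up to a constant.
  The oscillations get finer and lower, but not flatter.

  \<^emph>\<open>Boundedness.\<close> For an \<open>L\<close>-Lipschitz function the chain rule gives \<open>\<bar>(\<phi> \<circ> u)'\<bar> \<le> L \<cdot> \<bar>u'\<bar>\<close>, from which
  boundedness is immediate. Three facts about one variable lead to this inequality.
  A function with integrable weak derivative \<open>v\<close> is a constant plus the primitive of \<open>v\<close>
  (\<open>has_weak_deriv_imp_primitive\<close>, by the lemma of du Bois-Reymond), and conversely
  (\<open>has_weak_deriv_primitive\<close>, by Fubini). Finally, a real function \<open>w\<close> whose increments are dominated
  by those of the primitive \<open>G\<close> of \<open>g\<close> is itself a primitive, of some \<open>v\<close> with \<open>\<bar>v\<bar> \<le> g\<close>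
  (\<open>dominated_increments_imp_primitive\<close>). The function \<open>v\<close> arises from densities: \<open>G + w\<close> and
  \<open>G - w\<close> are nondecreasing and continuous, hence distribution functions of two measures whose sum
  has density \<open>2g\<close>; their Radon-Nikodym densities \<open>r\<close> and \<open>s\<close> give \<open>v = (r - s) / 2\<close>.
\<close>

section \<open>Smooth cutoff functions\<close>

text \<open>
  Smoothness is an iterated statement, and products and sums of smooth functions are treated by
  induction on the order. Recursion that peels off the innermost derivative fits this induction:
  the derivative of a product is again built from functions of the next lower order.
\<close>

primrec differentiable_upto :: "nat \<Rightarrow> (real \<Rightarrow> real) \<Rightarrow> bool" where
  "differentiable_upto 0 f \<longleftrightarrow> (\<forall>x. f field_differentiable at x)"
| "differentiable_upto (Suc n) f \<longleftrightarrow>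
     (\<forall>x. f field_differentiable at x) \<and> differentiable_upto n (deriv f)"

lemma differentiable_upto_imp_field_differentiable:
  "differentiable_upto n f \<Longrightarrow> f field_differentiable at x"
  by (cases n) auto

lemma differentiable_upto_mono: "differentiable_upto (Suc n) f \<Longrightarrow> differentiable_upto n f"
  by (induction n arbitrary: f) auto

lemma all_differentiable_upto_iff:
  "(\<forall>n. differentiable_upto n f) \<longleftrightarrow> (\<forall>n x. (deriv ^^ n) f field_differentiable at x)"
proof
  have "differentiable_upto n f \<Longrightarrow> (deriv ^^ n) f field_differentiable at x" for n x
  proof (induction n arbitrary: f)
    case (Suc n)
    then show ?case by (simp add: funpow_swap1)
  qed auto
  then show "\<forall>n. differentiable_upto n f \<Longrightarrow> \<forall>n x. (deriv ^^ n) f field_differentiable at x"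
    by blast
next
  have "(\<forall>m x. (deriv ^^ m) f field_differentiable at x) \<Longrightarrow> differentiable_upto n f" for n
  proof (induction n arbitrary: f)
    case 0
    then show ?case using spec[OF 0, of 0] by simp
  next
    case (Suc n)
    have "\<forall>x. f field_differentiable at x" using spec[OF Suc.prems, of 0] by simp
    moreover have "(deriv ^^ m) (deriv f) field_differentiable at x" for m x
      using spec[OF Suc.prems, of "Suc m"] by (simp add: funpow_swap1)
    ultimately show ?case using Suc.IH[of "deriv f"] by simp
  qed
  then show "\<forall>n x. (deriv ^^ n) f field_differentiable at x \<Longrightarrow> \<forall>n. differentiable_upto n f"
    by blast
qed

lemma differentiable_upto_add:
  "differentiable_upto n f \<Longrightarrow> differentiable_upto n g \<Longrightarrow> differentiable_upto n (\<lambda>x. f x + g x)"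
proof (induction n arbitrary: f g)
  case 0
  then show ?case by (auto intro: field_differentiable_add)
next
  case (Suc n)
  then have "deriv (\<lambda>x. f x + g x) = (\<lambda>x. deriv f x + deriv g x)" by (auto intro!: ext deriv_add)
  with Suc show ?case by (auto intro: field_differentiable_add)
qed

lemma differentiable_upto_mult:
  "differentiable_upto n f \<Longrightarrow> differentiable_upto n g \<Longrightarrow> differentiable_upto n (\<lambda>x. f x * g x)"
proof (induction n arbitrary: f g)
  case 0
  then show ?case by (auto intro: field_differentiable_mult)
next
  case (Suc n)
  then have "deriv (\<lambda>x. f x * g x) = (\<lambda>x. f x * deriv g x + deriv f x * g x)"
    by (auto intro!: ext deriv_mult)
  moreover have "differentiable_upto n f" "differentiable_upto n g"
    using Suc.prems differentiable_upto_mono by blast+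
  ultimately show ?case using Suc
    by (auto intro!: field_differentiable_mult differentiable_upto_add)
qed

lemma differentiable_upto_const: "differentiable_upto n (\<lambda>x. c)"
proof (induction n arbitrary: c)
  case (Suc n)
  have "deriv (\<lambda>x::real. c) = (\<lambda>x. 0)" by (auto intro!: ext)
  with Suc show ?case by auto
qed auto

lemma differentiable_upto_affine:
  "differentiable_upto n f \<Longrightarrow> differentiable_upto n (\<lambda>x. f (c * x + d))"
proof (induction n arbitrary: f)
  case 0
  have "((\<lambda>x. f (c * x + d)) has_field_derivative deriv f (c * x + d) * c) (at x)" for x
    using 0 by (auto intro!: DERIV_chain2[where g="\<lambda>x. c * x + d"] derivative_eq_intros
        simp: field_differentiable_derivI)
  then show ?case by (auto simp: field_differentiable_def)
next
  case (Suc n)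
  have *: "((\<lambda>x. f (c * x + d)) has_field_derivative deriv f (c * x + d) * c) (at x)" for x
    using Suc.prems by (auto intro!: DERIV_chain2[where g="\<lambda>x. c * x + d"] derivative_eq_intros
        simp: field_differentiable_derivI)
  then have "deriv (\<lambda>x. f (c * x + d)) = (\<lambda>x. deriv f (c * x + d) * c)"
    by (auto intro!: ext DERIV_imp_deriv)
  with Suc * show ?case
    by (auto simp: field_differentiable_def intro!: differentiable_upto_mult differentiable_upto_const)
qed

text \<open>
  For \<open>m = 0\<close> this is the standard smooth function that vanishes to infinite order at 0. The extra
  powers make the family closed under differentiation, up to linear combinations, so that all orders
  can be treated by one induction.
\<close>

definition flat :: "nat \<Rightarrow> real \<Rightarrow> real" where
  "flat m y = (if y > 0 then (1 / y) ^ m * exp (- (1 / y)) else 0)"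

lemma flat_tendsto_0: "(flat m \<longlongrightarrow> 0) (at 0)"
proof (rule filterlim_split_at)
  have "(flat m \<longlongrightarrow> 0) (at_left 0) = ((\<lambda>_. 0::real) \<longlongrightarrow> 0) (at_left (0::real))"
    by (rule tendsto_cong) (auto simp: eventually_at_filter flat_def)
  then show "(flat m \<longlongrightarrow> 0) (at_left 0)" by simp
  have "((\<lambda>y. inverse y ^ m / exp (inverse y)) \<longlongrightarrow> (0::real)) (at_right 0)"
    by (rule filterlim_compose[OF tendsto_power_div_exp_0 filterlim_inverse_at_top_right])
  moreover have "(flat m \<longlongrightarrow> 0) (at_right 0) =
      ((\<lambda>y. inverse y ^ m / exp (inverse y)) \<longlongrightarrow> (0::real)) (at_right 0)"
    by (rule tendsto_cong)
      (auto simp: eventually_at_filter flat_def field_simps exp_minus)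
  ultimately show "(flat m \<longlongrightarrow> 0) (at_right 0)" by simp
qed

text \<open>
  At 0 the difference quotient of \<open>flat m\<close> is \<open>flat (m + 1)\<close>, which tends to 0 because the exponential
  beats every power.
\<close>

lemma flat_has_derivative:
  "(flat m has_field_derivative flat (m + 2) y - real m * flat (m + 1) y) (at y)"
proof -
  consider "y > 0" | "y < 0" | "y = 0" by linarith
  then show ?thesis
  proof cases
    case 1
    have "((\<lambda>y. (1 / y) ^ m * exp (- (1 / y))) has_field_derivative
        flat (m + 2) y - real m * flat (m + 1) y) (at y)"
      using 1 by (auto intro!: derivative_eq_intros)
        (cases m; simp add: flat_def field_simps power2_eq_square)
    then show ?thesis
      by (rule has_field_derivative_transform_within_open[where S="{0<..}"])
        (use 1 in \<open>auto simp: flat_def\<close>)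
  next
    case 2
    have "((\<lambda>_. 0) has_field_derivative flat (m + 2) y - real m * flat (m + 1) y) (at y)"
      using 2 by (simp add: flat_def)
    then show ?thesis
      by (rule has_field_derivative_transform_within_open[where S="{..<0}"])
        (use 2 in \<open>auto simp: flat_def\<close>)
  next
    case 3
    have "((\<lambda>h. (flat m (0 + h) - flat m 0) / h) \<longlongrightarrow> 0) (at 0) = (flat (m + 1) \<longlongrightarrow> 0) (at 0)"
      by (rule tendsto_cong) (auto simp: eventually_at_filter flat_def)
    then have "(flat m has_field_derivative 0) (at 0)"
      using flat_tendsto_0 by (simp add: DERIV_def)
    then show ?thesis using 3 by (simp add: flat_def)
  qed
qed

lemma differentiable_upto_flat: "differentiable_upto n (flat m)"
proof (induction n arbitrary: m)
  case 0
  then show ?case using flat_has_derivative by (auto simp: field_differentiable_def)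
next
  case (Suc n)
  have "deriv (flat m) = (\<lambda>y. flat (m + 2) y + - real m * flat (m + 1) y)"
    using flat_has_derivative by (force intro!: DERIV_imp_deriv)
  moreover have "differentiable_upto n (\<lambda>y. flat (m + 2) y + - real m * flat (m + 1) y)"
    by (intro differentiable_upto_add differentiable_upto_mult differentiable_upto_const Suc)
  ultimately show ?case
    using flat_has_derivative by (simp add: field_differentiable_def) blast
qed

text \<open>
  As \<open>k\<close> grows, these functions, which are supported in \<open>{a..b}\<close>, increase to the indicator of the
  open interval; for \<open>b \<le> a\<close> they vanish.
\<close>

definition bump :: "real \<Rightarrow> real \<Rightarrow> real \<Rightarrow> real \<Rightarrow> real" where
  "bump a b k x = flat 0 (k * x + - k * a) * flat 0 (- k * x + k * b)"

lemma differentiable_upto_bump: "differentiable_upto n (bump a b k)"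
  unfolding bump_def
  by (intro differentiable_upto_mult differentiable_upto_affine differentiable_upto_flat)

lemma bump_eq_0: "k > 0 \<Longrightarrow> x \<notin> {a<..<b} \<Longrightarrow> bump a b k x = 0"
  by (auto simp: bump_def flat_def simp flip: right_diff_distrib distrib_left)
     (auto simp: zero_less_mult_iff algebra_simps)

lemma bump_bounded: "\<bar>bump a b k x\<bar> \<le> 1"
proof -
  have "\<bar>flat 0 y\<bar> \<le> 1" for y by (auto simp: flat_def)
  then show ?thesis unfolding bump_def abs_mult by (intro mult_le_one) auto
qed

lemma bump_tendsto: "(\<lambda>k. bump a b (real (Suc k)) x) \<longlonglongrightarrow> indicator {a<..<b} x"
proof (cases "x \<in> {a<..<b}")
  case True
  have flat1: "(\<lambda>k. flat 0 (real (Suc k) * d)) \<longlonglongrightarrow> 1" if "d > 0" for d :: real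
  proof -
    have "(\<lambda>k. exp (- (inverse (real (Suc k)) * (1 / d)))) \<longlonglongrightarrow> exp (- (0 * (1 / d)))"
      by (intro tendsto_intros LIMSEQ_inverse_real_of_nat)
    also have "(\<lambda>k. exp (- (inverse (real (Suc k)) * (1 / d)))) = (\<lambda>k. flat 0 (real (Suc k) * d))"
      using that by (auto simp: flat_def divide_inverse zero_less_mult_iff)
    finally show ?thesis by simp
  qed
  have "(\<lambda>k. flat 0 (real (Suc k) * (x - a)) * flat 0 (real (Suc k) * (b - x))) \<longlonglongrightarrow> 1 * 1"
    using True by (intro tendsto_mult flat1) auto
  then show ?thesis using True by (simp add: bump_def algebra_simps)
next
  case False
  have "bump a b (real (Suc k)) x = 0" for k by (rule bump_eq_0) (use False in auto)
  then show ?thesis using False by simp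
qed

lemma test_functionI:
  assumes "\<And>n. differentiable_upto n \<psi>" and "0 < a" "b < 1" and "\<And>x. x \<notin> {a..b} \<Longrightarrow> \<psi> x = 0"
  shows "test_function \<psi>"
proof -
  have sub: "closure {x. \<psi> x \<noteq> 0} \<subseteq> {a..b}"
    using assms(4) by (intro closure_minimal) (blast, simp)
  then have "compact (closure {x. \<psi> x \<noteq> 0})"
    by (meson bounded_closed_interval bounded_subset closed_closure compact_eq_bounded_closed)
  moreover have "closure {x. \<psi> x \<noteq> 0} \<subseteq> {0<..<1}" using sub assms(2,3) by auto
  ultimately show ?thesis
    using assms(1) all_differentiable_upto_iff[of \<psi>] by (simp add: test_function_def)
qed

lemma test_function_bump:
  assumes "0 < a" "b < 1"
  shows "test_function (bump a b (real (Suc k)))"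
  using assms by (intro test_functionI[of _ a b] differentiable_upto_bump bump_eq_0) auto

lemma test_function_differentiable_upto: "test_function \<psi> \<Longrightarrow> differentiable_upto n \<psi>"
  using all_differentiable_upto_iff by (auto simp: test_function_def)

lemma differentiable_upto_imp_continuous_on: "differentiable_upto n f \<Longrightarrow> continuous_on S f"
  by (metis differentiable_upto_imp_field_differentiable continuous_at_imp_continuous_on
      field_differentiable_imp_continuous_at)

text \<open>
  The primitive starting at 0 vanishes to the left of the support of \<open>\<eta>\<close>, and to the right of it
  exactly because \<open>\<eta>\<close> has mean zero.
\<close>

lemma test_function_primitive:
  assumes smooth: "\<And>n. differentiable_upto n \<eta>" and ab: "0 < a" "a \<le> b" "b < 1"
    and supp: "\<And>x. x \<notin> {a..b} \<Longrightarrow> \<eta> x = 0" and mean: "integral {0..1} \<eta> = 0"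
  obtains \<psi> where "test_function \<psi>" "deriv \<psi> = \<eta>"
proof -
  define \<psi> where "\<psi> x = integral {0..x} \<eta>" for x
  note cont = differentiable_upto_imp_continuous_on[OF smooth[of 0]]
  have left: "\<psi> x = 0" if "x \<le> a" for x
  proof -
    have "integral {0..x} \<eta> = integral {0..x} (\<lambda>x. 0)"
      using that by (intro integral_spike[where S="{a}"]) (auto intro!: supp)
    then show ?thesis by (simp add: \<psi>_def)
  qed
  have right: "\<psi> x = 0" if "x \<ge> b" for x
  proof -
    have *: "integral {y..z} \<eta> = 0" if "b \<le> y" for y z
    proof -
      have "integral {y..z} \<eta> = integral {y..z} (\<lambda>x. 0)"
        using that by (intro integral_spike[where S="{b}"]) (auto intro!: supp)
      then show ?thesis by simp
    qed
    have "integral {0..b} \<eta> + integral {b..1} \<eta> = integral {0..1} \<eta>"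
      using ab by (intro Henstock_Kurzweil_Integration.integral_combine integrable_continuous_real cont) auto
    moreover have "integral {0..b} \<eta> + integral {b..x} \<eta> = integral {0..x} \<eta>"
      using ab that by (intro Henstock_Kurzweil_Integration.integral_combine integrable_continuous_real cont) auto
    ultimately show ?thesis using * mean by (simp add: \<psi>_def)
  qed
  have D: "(\<psi> has_field_derivative \<eta> x) (at x)" for x
  proof (cases "x < a")
    case True
    have "((\<lambda>_. 0) has_field_derivative \<eta> x) (at x)" using True supp[of x] by simp
    then show ?thesis
      by (rule has_field_derivative_transform_within_open[where S="{..<a}"]) (use True left in auto)
  next
    case False
    have "(\<psi> has_field_derivative \<eta> x) (at x within {0..x + 1})"
      unfolding \<psi>_def by (rule integral_has_real_derivative[OF cont]) (use False ab in auto)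
    moreover have "at x within {0..x + 1} = at x"
      using False ab by (intro at_within_interior) (auto simp: interior_atLeastAtMost_real)
    ultimately show ?thesis by simp
  qed
  then have d: "deriv \<psi> = \<eta>" by (auto intro!: ext DERIV_imp_deriv)
  have "differentiable_upto n \<psi>" for n
    using D d smooth by (cases n) (auto simp: field_differentiable_def)
  then have "test_function \<psi>" by (rule test_functionI[of _ a b]) (use ab left right in auto)
  with d that show thesis by blast
qed

section \<open>Integration on the unit interval\<close>

lemma finite_unit_interval_measure: "finite_measure unit_interval_measure"
  by (intro finite_measure_lebesgue_on) auto

lemma sets_unit_interval_measure: "A \<in> sets borel \<Longrightarrow> A \<inter> {0..1} \<in> sets unit_interval_measure"
  by (auto simp: sets_restrict_space)

lemma borel_measurable_unit_interval:
  "f \<in> borel_measurable borel \<Longrightarrow> f \<in> borel_measurable unit_interval_measure"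
  by (intro measurable_restrict_space1 measurable_completion) simp

lemma AE_unit_interval_neq: "AE x in unit_interval_measure. x \<noteq> c"
proof -
  have "AE x in lebesgue. x \<noteq> c" using AE_lborel_singleton by (rule AE_completion)
  then show ?thesis by (subst AE_restrict_space_iff) auto
qed

lemma integrable_bounded_scaleR:
  fixes f :: "real \<Rightarrow> 'a::euclidean_space"
  assumes "integrable unit_interval_measure f" "\<eta> \<in> borel_measurable borel" "\<And>x. \<bar>\<eta> x\<bar> \<le> B"
  shows "integrable unit_interval_measure (\<lambda>x. \<eta> x *\<^sub>R f x)"
proof (rule Bochner_Integration.integrable_bound)
  show "integrable unit_interval_measure (\<lambda>x. B *\<^sub>R norm (f x))" using assms(1) by simp
  show "(\<lambda>x. \<eta> x *\<^sub>R f x) \<in> borel_measurable unit_interval_measure"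
    using assms(2) borel_measurable_integrable[OF assms(1)]
    by (intro borel_measurable_scaleR) (auto intro: borel_measurable_unit_interval)
  show "AE x in unit_interval_measure. norm (\<eta> x *\<^sub>R f x) \<le> norm (B *\<^sub>R norm (f x))"
    using assms(3) by (auto intro!: AE_I2 mult_right_mono order_trans[OF _ abs_ge_self])
qed

lemma integrable_indicator_scaleR:
  fixes f :: "real \<Rightarrow> 'a::euclidean_space"
  assumes "integrable unit_interval_measure f" "A \<in> sets borel"
  shows "integrable unit_interval_measure (\<lambda>x. indicator A x *\<^sub>R f x)"
  using assms by (intro integrable_bounded_scaleR[where B=1]) auto

lemma integral_UN_disjoint_borel:
  fixes f :: "real \<Rightarrow> 'a::euclidean_space"
  assumes f: "integrable unit_interval_measure f"
    and A: "disjoint_family A" "\<And>i::nat. A i \<in> sets borel"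
  shows "(LINT x|unit_interval_measure. indicator (\<Union>i. A i) x *\<^sub>R f x) =
         (\<Sum>i. LINT x|unit_interval_measure. indicator (A i) x *\<^sub>R f x)"
proof -
  have eq: "(LINT x|unit_interval_measure. indicator B x *\<^sub>R f x) =
      (LINT x:(B \<inter> {0..1})|unit_interval_measure. f x)" for B
    unfolding set_lebesgue_integral_def
    by (rule Bochner_Integration.integral_cong) (auto simp: indicator_def)
  have "(LINT x:(\<Union>i. A i \<inter> {0..1})|unit_interval_measure. f x) =
        (\<Sum>i. LINT x:(A i \<inter> {0..1})|unit_interval_measure. f x)"
  proof (rule lebesgue_integral_countable_add)
    have "(\<Union>i. A i \<inter> {0..1}) \<in> sets unit_interval_measure"
      using A sets_unit_interval_measure by blast
    then show "set_integrable unit_interval_measure (\<Union>i. A i \<inter> {0..1}) f"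
      unfolding set_integrable_def using f by (intro integrable_mult_indicator)
  qed (use A sets_unit_interval_measure in \<open>auto simp: disjoint_family_on_def\<close>)
  then show ?thesis unfolding eq by (simp only: UN_simps)
qed

lemma integral_Compl_borel:
  fixes f :: "real \<Rightarrow> 'a::euclidean_space"
  assumes "integrable unit_interval_measure f" "A \<in> sets borel"
  shows "(LINT x|unit_interval_measure. indicator (- A) x *\<^sub>R f x) =
    (LINT x|unit_interval_measure. f x) - (LINT x|unit_interval_measure. indicator A x *\<^sub>R f x)"
proof -
  have "(LINT x|unit_interval_measure. indicator (-A) x *\<^sub>R f x) =
      (LINT x|unit_interval_measure. f x - indicator A x *\<^sub>R f x)"
    by (rule Bochner_Integration.integral_cong) (auto simp: indicator_def)
  then show ?thesis using assms by (simp add: integrable_indicator_scaleR)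
qed

text \<open>
  The sets over which \<open>h\<close> integrates to zero form a Dynkin system, so they include all Borel sets
  once they include the intervals; a Lebesgue set differs from a Borel set by a null set.
\<close>

lemma AE_eq_0_if_interval_integrals_eq_0:
  fixes h :: "real \<Rightarrow> 'a::euclidean_space"
  assumes h: "integrable unit_interval_measure h"
    and interval: "\<And>a b. 0 \<le> a \<Longrightarrow> a \<le> b \<Longrightarrow> b \<le> 1 \<Longrightarrow>
      (LINT x|unit_interval_measure. indicator {a..b} x *\<^sub>R h x) = 0"
  shows "AE x in unit_interval_measure. h x = 0"
proof -
  have borel: "(LINT x|unit_interval_measure. indicator A x *\<^sub>R h x) = 0" if "A \<in> sets borel" for A
    using that
  proof (induction A rule: borel_set_induct)
    case (interval a b)
    have "(LINT x|unit_interval_measure. indicator {a..b} x *\<^sub>R h x) =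
        (LINT x|unit_interval_measure. indicator {max a 0..min b 1} x *\<^sub>R h x)"
      by (rule Bochner_Integration.integral_cong) (auto simp: indicator_def)
    also have "\<dots> = 0" using assms(2)[of "max a 0" "min b 1"]
      by (cases "max a 0 \<le> min b 1") auto
    finally show ?case .
  next
    case (compl A)
    have "(LINT x|unit_interval_measure. h x) =
        (LINT x|unit_interval_measure. indicator {0..1} x *\<^sub>R h x)"
      by (rule Bochner_Integration.integral_cong) (auto simp: indicator_def)
    then have "(LINT x|unit_interval_measure. h x) = 0" using assms(2)[of 0 1] by simp
    then show ?case using compl h by (simp add: integral_Compl_borel)
  next
    case (union A)
    then show ?case using h by (simp add: integral_UN_disjoint_borel)
  qed simp
  show ?thesis
  proof (rule sigma_finite_measure.density_zero[OF _ h])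
    show "sigma_finite_measure unit_interval_measure"
      using finite_unit_interval_measure by (simp add: finite_measure_def)
    fix A assume "A \<in> sets unit_interval_measure"
    then have "A \<in> sets lebesgue" and sub: "A \<subseteq> {0..1}"
      by (auto simp: sets_restrict_space)
    \<comment> \<open>Up to a null set, the Lebesgue set \<open>A\<close> is the Borel set \<open>S\<close>.\<close>
    then obtain S N N' where A: "A = S \<union> N" "N \<subseteq> N'" "N' \<in> null_sets lborel" "S \<in> sets lborel"
      by (meson sets_completionE)
    have "AE x in lebesgue. x \<notin> N'" using A(3) by (intro AE_completion AE_not_in)
    then have "AE x in unit_interval_measure. x \<notin> N'" by (subst AE_restrict_space_iff) auto
    moreover have "S \<inter> {0..1} \<in> sets unit_interval_measure"
      using A(4) by (intro sets_unit_interval_measure) simp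
    moreover have "S = S \<inter> {0..1}" using A(1) sub by auto
    ultimately have "set_lebesgue_integral unit_interval_measure A h =
        (LINT x|unit_interval_measure. indicator S x *\<^sub>R h x)"
      unfolding set_lebesgue_integral_def
      using A(1,2) h \<open>A \<in> sets unit_interval_measure\<close>
      by (intro integral_cong_AE borel_measurable_scaleR borel_measurable_indicator)
        (auto simp: indicator_def split: if_splits)
    then show "set_lebesgue_integral unit_interval_measure A h = 0"
      using borel A(4) by simp
  qed
qed

lemma integrable_imp_locally_integrable:
  fixes f :: "real \<Rightarrow> 'a::euclidean_space"
  assumes "integrable unit_interval_measure f"
  shows "locally_integrable f"
  unfolding locally_integrable_def
proof (intro allI impI)
  fix K :: "real set" assume K: "compact K \<and> K \<subseteq> {0<..<1}"
  then have "K \<in> sets borel" by (simp add: borel_compact)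
  then have L: "K \<in> sets lebesgue" by simp
  have "integrable unit_interval_measure (\<lambda>x. indicator K x *\<^sub>R f x)"
    using assms \<open>K \<in> sets borel\<close> by (rule integrable_indicator_scaleR)
  then have "integrable lebesgue (\<lambda>x. indicator {0..1} x *\<^sub>R indicator K x *\<^sub>R f x)"
    by (subst (asm) integrable_restrict_space) auto
  also have "(\<lambda>x. indicator {0..1} x *\<^sub>R indicator K x *\<^sub>R f x) = (\<lambda>x. indicator K x *\<^sub>R f x)"
    using K by (intro ext) (auto simp: indicator_def subset_eq)
  finally show "integrable (lebesgue_on K) f"
    using L by (subst integrable_restrict_space) auto
qed

lemma locally_integrable_cutoff:
  fixes f :: "real \<Rightarrow> 'a::euclidean_space"
  assumes "locally_integrable f" "0 < a" "b < 1"
  shows "integrable unit_interval_measure (\<lambda>x. indicator {a..b} x *\<^sub>R f x)"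
proof -
  have "integrable (lebesgue_on {a..b}) f"
    using assms unfolding locally_integrable_def by (auto dest!: spec[of _ "{a..b}"])
  then have "integrable lebesgue (\<lambda>x. indicator {a..b} x *\<^sub>R f x)"
    by (subst (asm) integrable_restrict_space) auto
  also have "(\<lambda>x. indicator {a..b} x *\<^sub>R f x) = (\<lambda>x. indicator {0..1} x *\<^sub>R indicator {a..b} x *\<^sub>R f x)"
    using assms by (auto simp: indicator_def)
  finally show ?thesis by (subst integrable_restrict_space) auto
qed

text \<open>
  The index shift by 2 keeps the interval nonempty from \<open>n = 0\<close> on and inside the open unit interval.
\<close>

definition cutoff :: "nat \<Rightarrow> real \<Rightarrow> real" where
  "cutoff n = indicator {inverse (real (Suc (Suc n))) .. 1 - inverse (real (Suc (Suc n)))}"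

lemma cutoff_tendsto: "(\<lambda>n. cutoff n x) \<longlonglongrightarrow> indicator {0<..<1} x"
proof -
  have lim: "(\<lambda>n. inverse (real (Suc (Suc n)))) \<longlonglongrightarrow> 0"
    using LIMSEQ_inverse_real_of_nat by (rule LIMSEQ_Suc)
  have "\<forall>\<^sub>F n in sequentially. cutoff n x = indicator {0<..<1} x"
  proof (cases "x \<in> {0<..<1}")
    case True
    then have "\<forall>\<^sub>F n in sequentially. inverse (real (Suc (Suc n))) < x"
       "\<forall>\<^sub>F n in sequentially. inverse (real (Suc (Suc n))) < 1 - x"
      using order_tendstoD(2)[OF lim, of x] order_tendstoD(2)[OF lim, of "1 - x"] by auto
    then show ?thesis
      by eventually_elim (use True in \<open>auto simp: cutoff_def indicator_def simp del: of_nat_Suc\<close>)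
  next
    case False
    have "inverse (real (Suc (Suc n))) > 0" for n by simp
    then have "cutoff n x = indicator {0<..<1} x" for n
      using False by (smt (verit) atLeastAtMost_iff cutoff_def greaterThanLessThan_iff indicator_simps(2))
    then show ?thesis by simp
  qed
  then show ?thesis by (rule tendsto_eventually)
qed

text \<open>
  Local integrability gives measurability on each compact subinterval of the open unit interval;
  exhausting it leaves only the two end points, where the value does not affect measurability.
\<close>

lemma locally_integrable_measurable:
  fixes f :: "real \<Rightarrow> 'a::euclidean_space"
  assumes "locally_integrable f"
  shows "f \<in> borel_measurable unit_interval_measure"
proof -
  have "(\<lambda>x. indicator {0<..<1} x *\<^sub>R f x) \<in> borel_measurable unit_interval_measure"
  proof (rule borel_measurable_LIMSEQ_metric)
    show "(\<lambda>x. cutoff n x *\<^sub>R f x) \<in> borel_measurable unit_interval_measure" for n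
      unfolding cutoff_def by (intro borel_measurable_integrable locally_integrable_cutoff assms) auto
    show "(\<lambda>n. cutoff n x *\<^sub>R f x) \<longlonglongrightarrow> indicator {0<..<1} x *\<^sub>R f x" for x
      by (intro tendsto_scaleR cutoff_tendsto tendsto_const)
  qed
  \<comment> \<open>The end points contribute a Borel function with two-point support.\<close>
  moreover have "(\<lambda>x. indicator {0} x *\<^sub>R f 0 + indicator {1} x *\<^sub>R f 1) \<in> borel_measurable unit_interval_measure"
    by (intro borel_measurable_unit_interval) simp
  ultimately have "(\<lambda>x. indicator {0<..<1} x *\<^sub>R f x + (indicator {0} x *\<^sub>R f 0 + indicator {1} x *\<^sub>R f 1))
      \<in> borel_measurable unit_interval_measure" by (rule borel_measurable_add)
  then show ?thesis
    by (rule measurable_cong[THEN iffD1, rotated]) (auto simp: indicator_def)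
qed

lemma bump_measurable: "bump a b k \<in> borel_measurable borel"
  using differentiable_upto_bump differentiable_upto_imp_continuous_on
  by (intro borel_measurable_continuous_onI) blast

section \<open>Test functions and uniqueness of weak derivatives\<close>

lemma integral_bump_tendsto:
  fixes f :: "real \<Rightarrow> 'a::euclidean_space"
  assumes "integrable unit_interval_measure f"
  shows "(\<lambda>k. LINT x|unit_interval_measure. bump a b (real (Suc k)) x *\<^sub>R f x) \<longlonglongrightarrow>
         (LINT x|unit_interval_measure. indicator {a..b} x *\<^sub>R f x)"
proof (rule integral_dominated_convergence[where w="\<lambda>x. norm (f x)"])
  show "AE x in unit_interval_measure.
      (\<lambda>k. bump a b (real (Suc k)) x *\<^sub>R f x) \<longlonglongrightarrow> indicator {a..b} x *\<^sub>R f x"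
    using AE_unit_interval_neq[of a] AE_unit_interval_neq[of b]
  proof eventually_elim
    case (elim x)
    then have "indicator {a..b} x = (indicator {a<..<b} x :: real)" by (auto simp: indicator_def)
    then show ?case by (simp only:) (intro tendsto_scaleR bump_tendsto tendsto_const)
  qed
  show "AE x in unit_interval_measure. norm (bump a b (real (Suc k)) x *\<^sub>R f x) \<le> norm (f x)" for k
    using bump_bounded by (auto intro!: mult_left_le_one_le)
  show "(\<lambda>x. bump a b (real (Suc k)) x *\<^sub>R f x) \<in> borel_measurable unit_interval_measure" for k
    using integrable_bounded_scaleR[OF assms bump_measurable bump_bounded]
    by (rule borel_measurable_integrable)
  show "(\<lambda>x. indicator {a..b} x *\<^sub>R f x) \<in> borel_measurable unit_interval_measure"
    using integrable_indicator_scaleR[OF assms, of "{a..b}"] by (intro borel_measurable_integrable) simp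
  show "integrable unit_interval_measure (\<lambda>x. norm (f x))" using assms by simp
qed

text \<open>
  Bumps are test functions that converge to indicators, so \<open>f\<close> integrates to zero over every interval
  with closure in the open unit interval. The cutoff makes \<open>f\<close> integrable on the whole interval.
\<close>

lemma fundamental_lemma_calculus_of_variations:
  fixes f :: "real \<Rightarrow> 'a::euclidean_space"
  assumes f: "locally_integrable f"
    and test: "\<And>\<psi>. test_function \<psi> \<Longrightarrow> (LINT x|unit_interval_measure. \<psi> x *\<^sub>R f x) = 0"
  shows "AE x in unit_interval_measure. f x = 0"
proof -
  have "AE x in unit_interval_measure. cutoff n x *\<^sub>R f x = 0" for n
  proof (rule AE_eq_0_if_interval_integrals_eq_0)
    define c where "c = inverse (real (Suc (Suc n)))"
    have c: "0 < c" by (simp add: c_def)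
    have cut: "cutoff n = indicator {c..1-c}" by (simp add: cutoff_def c_def)
    show int: "integrable unit_interval_measure (\<lambda>x. cutoff n x *\<^sub>R f x)"
      unfolding cut using f c by (intro locally_integrable_cutoff) auto
    fix a b :: real
    \<comment> \<open>The cutoff restricts every interval to \<open>{c..1 - c}\<close>, where bumps are admissible.\<close>
    define a' b' where "a' = max a c" and "b' = min b (1 - c)"
    have bump: "bump a' b' (real (Suc k)) x *\<^sub>R cutoff n x *\<^sub>R f x = bump a' b' (real (Suc k)) x *\<^sub>R f x"
      for k x
    proof (cases "x \<in> {c..1-c}")
      case False
      then have "bump a' b' (real (Suc k)) x = 0"
        by (intro bump_eq_0) (auto simp: a'_def b'_def)
      then show ?thesis by simp
    qed (simp add: cut)
    have "(LINT x|unit_interval_measure. bump a' b' (real (Suc k)) x *\<^sub>R f x) = 0" for k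
      using c by (intro test test_function_bump) (auto simp: a'_def b'_def)
    then have "(LINT x|unit_interval_measure. indicator {a'..b'} x *\<^sub>R cutoff n x *\<^sub>R f x) = 0"
      using integral_bump_tendsto[OF int, of a' b'] unfolding bump by (simp add: LIMSEQ_const_iff)
    moreover have "indicator {a'..b'} x *\<^sub>R cutoff n x *\<^sub>R f x = indicator {a..b} x *\<^sub>R cutoff n x *\<^sub>R f x"
      for x by (auto simp: cut indicator_def a'_def b'_def)
    ultimately show "(LINT x|unit_interval_measure. indicator {a..b} x *\<^sub>R cutoff n x *\<^sub>R f x) = 0"
      by (simp only:)
  qed
  then have "AE x in unit_interval_measure. \<forall>n. cutoff n x *\<^sub>R f x = 0"
    unfolding AE_all_countable by blast
  then show ?thesis
    using AE_unit_interval_neq[of 0] AE_unit_interval_neq[of 1] AE_space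
  proof eventually_elim
    case (elim x)
    have "(\<lambda>n. cutoff n x *\<^sub>R f x) \<longlonglongrightarrow> indicator {0<..<1} x *\<^sub>R f x"
      by (intro tendsto_scaleR cutoff_tendsto tendsto_const)
    then have "indicator {0<..<1} x *\<^sub>R f x = 0" using elim(1) by (simp add: LIMSEQ_const_iff)
    moreover have "x \<in> {0<..<1}" using elim(2-4) by auto
    ultimately show ?case by simp
  qed
qed

text \<open>
  The compact closure of the support has a least and a greatest element; if it is empty, any
  interval will do.
\<close>

lemma test_function_support:
  assumes "test_function \<psi>"
  obtains a b where "0 < a" "a \<le> b" "b < 1" "\<And>x. x \<notin> {a..b} \<Longrightarrow> \<psi> x = 0"
proof (cases "closure {x. \<psi> x \<noteq> 0} = {}")
  case True
  then show thesis by (intro that[of "1/2" "1/2"]) auto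
next
  case False
  let ?K = "closure {x. \<psi> x \<noteq> 0}"
  have K: "compact ?K" "?K \<subseteq> {0<..<1}" using assms by (auto simp: test_function_def)
  obtain a where a: "a \<in> ?K" "\<forall>x\<in>?K. a \<le> x" using compact_attains_inf[OF K(1) False] by blast
  obtain b where b: "b \<in> ?K" "\<forall>x\<in>?K. x \<le> b" using compact_attains_sup[OF K(1) False] by blast
  have "\<psi> x = 0" if "x \<notin> {a..b}" for x
    using that a(2) b(2) closure_subset[of "{x. \<psi> x \<noteq> 0}"] by auto
  moreover have "a \<in> {0<..<1}" "b \<in> {0<..<1}" using a(1) b(1) K(2) by blast+
  moreover have "a \<le> b" using a(2) b(1) by blast
  ultimately show thesis by (intro that[of a b]) auto
qed

lemma test_function_deriv:
  assumes "test_function \<psi>"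
  shows "test_function (deriv \<psi>)"
proof -
  obtain a b where ab: "0 < a" "a \<le> b" "b < 1" "\<And>x. x \<notin> {a..b} \<Longrightarrow> \<psi> x = 0"
    using test_function_support[OF assms] by metis
  show ?thesis
  proof (rule test_functionI)
    show "differentiable_upto n (deriv \<psi>)" for n
      using test_function_differentiable_upto[OF assms, of "Suc n"] by simp
    fix x assume x: "x \<notin> {a..b}"
    have "(\<psi> has_field_derivative 0) (at x)"
      by (rule has_field_derivative_transform_within_open[where f="\<lambda>_. 0" and S="- {a..b}"])
        (use x ab(4) in auto)
    then show "deriv \<psi> x = 0" by (rule DERIV_imp_deriv)
  qed (use ab in auto)
qed

lemma test_function_continuous_on: "test_function \<psi> \<Longrightarrow> continuous_on S \<psi>"
  using test_function_differentiable_upto differentiable_upto_imp_continuous_on by blast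

lemma test_function_measurable: "test_function \<psi> \<Longrightarrow> \<psi> \<in> borel_measurable borel"
  by (intro borel_measurable_continuous_onI test_function_continuous_on)

lemma test_function_has_derivative:
  "test_function \<psi> \<Longrightarrow> (\<psi> has_field_derivative deriv \<psi> x) (at x)"
  using test_function_differentiable_upto[of \<psi> 0] by (simp add: field_differentiable_derivI)

lemma test_function_bounded:
  assumes "test_function \<psi>"
  obtains B where "\<And>x. \<bar>\<psi> x\<bar> \<le> B"
proof -
  obtain a b where ab: "0 < a" "a \<le> b" "b < 1" "\<And>x. x \<notin> {a..b} \<Longrightarrow> \<psi> x = 0"
    using test_function_support[OF assms] by metis
  have "bounded (\<psi> ` {a..b})"
    using assms by (intro compact_imp_bounded compact_continuous_image test_function_continuous_on) auto
  then obtain B where "\<And>x. x \<in> {a..b} \<Longrightarrow> \<bar>\<psi> x\<bar> \<le> B"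
    unfolding bounded_iff by (metis imageI real_norm_def)
  then have "\<bar>\<psi> x\<bar> \<le> max B 0" for x using ab(4)[of x] by (cases "x \<in> {a..b}") (auto simp: le_max_iff_disj)
  then show thesis by (rule that)
qed

lemma integrable_test_function_scaleR:
  fixes f :: "real \<Rightarrow> 'a::euclidean_space"
  assumes "test_function \<psi>" "locally_integrable f"
  shows "integrable unit_interval_measure (\<lambda>x. \<psi> x *\<^sub>R f x)"
proof -
  obtain a b where ab: "0 < a" "a \<le> b" "b < 1" "\<And>x. x \<notin> {a..b} \<Longrightarrow> \<psi> x = 0"
    using test_function_support[OF assms(1)] by metis
  obtain B where B: "\<And>x. \<bar>\<psi> x\<bar> \<le> B" using test_function_bounded[OF assms(1)] by metis
  have "integrable unit_interval_measure (\<lambda>x. \<psi> x *\<^sub>R indicator {a..b} x *\<^sub>R f x)"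
    using assms ab B
    by (intro integrable_bounded_scaleR[where B=B] locally_integrable_cutoff test_function_measurable)
  also have "(\<lambda>x. \<psi> x *\<^sub>R indicator {a..b} x *\<^sub>R f x) = (\<lambda>x. \<psi> x *\<^sub>R f x)"
    using ab(4) by (intro ext) (auto simp: indicator_def)
  finally show ?thesis .
qed

lemma integral_continuous_unit_interval:
  fixes f :: "real \<Rightarrow> real"
  assumes "continuous_on {0..1} f"
  shows "integral\<^sup>L unit_interval_measure f = integral {0..1} f"
  using assms by (intro lebesgue_integral_eq_integral continuous_imp_integrable_real) auto

lemma integral_deriv_test_function:
  assumes "test_function \<psi>"
  shows "integral\<^sup>L unit_interval_measure (deriv \<psi>) = 0"
proof -
  have "((deriv \<psi>) has_integral (\<psi> 1 - \<psi> 0)) {0..1}"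
    using test_function_has_derivative[OF assms]
    by (intro fundamental_theorem_of_calculus)
      (auto simp: has_real_derivative_iff_has_vector_derivative has_vector_derivative_at_within)
  moreover have "\<psi> 1 = 0" "\<psi> 0 = 0"
    using test_function_support[OF assms] by (metis atLeastAtMost_iff not_le)+
  ultimately show ?thesis
    using integral_continuous_unit_interval[OF test_function_continuous_on[OF test_function_deriv[OF assms]]]
    by (simp add: integral_unique)
qed

lemma has_weak_deriv_unique:
  fixes u :: "real \<Rightarrow> 'a::euclidean_space"
  assumes "has_weak_deriv u v" "has_weak_deriv u w"
  shows "AE x in unit_interval_measure. v x = w x"
proof -
  have loc: "locally_integrable v" "locally_integrable w" using assms by (auto simp: has_weak_deriv_def)
  have "AE x in unit_interval_measure. v x - w x = 0"
  proof (rule fundamental_lemma_calculus_of_variations)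
    show "locally_integrable (\<lambda>x. v x - w x)" using loc by (auto simp: locally_integrable_def)
    fix \<psi> :: "real \<Rightarrow> real" assume \<psi>: "test_function \<psi>"
    have "(LINT x|unit_interval_measure. \<psi> x *\<^sub>R v x) = (LINT x|unit_interval_measure. \<psi> x *\<^sub>R w x)"
    proof -
      have "- (LINT x|unit_interval_measure. \<psi> x *\<^sub>R v x) = - (LINT x|unit_interval_measure. \<psi> x *\<^sub>R w x)"
        using assms \<psi> by (simp add: has_weak_deriv_def)
      then show ?thesis by (simp only: neg_equal_iff_equal)
    qed
    then show "(LINT x|unit_interval_measure. \<psi> x *\<^sub>R (v x - w x)) = 0"
      using Bochner_Integration.integral_diff[OF integrable_test_function_scaleR[OF \<psi> loc(1)]
          integrable_test_function_scaleR[OF \<psi> loc(2)]]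
      by (simp add: scaleR_diff_right)
  qed
  then show ?thesis by simp
qed

text \<open>
  A test function \<open>\<eta>\<close> is the derivative of another one once its mean has been removed by subtracting
  a multiple of a fixed \<open>\<eta>0\<close> with nonzero mean. Hence \<open>f\<close> has the same integral against \<open>\<eta>\<close> as the
  constant \<open>c\<close> that is the \<open>\<eta>0\<close>-average of \<open>f\<close>, and the fundamental lemma applies to \<open>f - c\<close>.
\<close>

lemma du_Bois_Reymond:
  fixes f :: "real \<Rightarrow> 'a::euclidean_space"
  assumes f: "integrable unit_interval_measure f"
    and weak: "\<And>\<psi>. test_function \<psi> \<Longrightarrow> (LINT x|unit_interval_measure. deriv \<psi> x *\<^sub>R f x) = 0"
  obtains c where "AE x in unit_interval_measure. f x = c"
proof -
  interpret finite_measure unit_interval_measure by (rule finite_unit_interval_measure)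
  note loc = integrable_imp_locally_integrable
  obtain \<eta>0 :: "real \<Rightarrow> real" where \<eta>0: "test_function \<eta>0" "integral {0..1} \<eta>0 \<noteq> 0"
  proof -
    let ?b = "\<lambda>k. bump (1/4) (1/2) (real (Suc k))"
    have test: "test_function (?b k)" for k by (intro test_function_bump) auto
    have "(\<lambda>k. LINT x|unit_interval_measure. ?b k x *\<^sub>R (1::real)) \<longlonglongrightarrow>
         (LINT x|unit_interval_measure. indicator {1/4..1/2} x *\<^sub>R 1)"
      by (rule integral_bump_tendsto) simp
    moreover have "(LINT x|unit_interval_measure. indicator {1/4..1/2} x *\<^sub>R (1::real)) = 1/4"
    proof -
      have "(LINT x|unit_interval_measure. indicator {1/4..1/2} x *\<^sub>R (1::real)) =
          (LINT x::real|lebesgue. indicator {0..1} x *\<^sub>R indicator {1/4..1/2} x *\<^sub>R (1::real))"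
        by (subst integral_restrict_space) auto
      also have "\<dots> = (LINT x::real|lebesgue. indicator {1/4..1/2} x)"
        by (rule Bochner_Integration.integral_cong) (auto simp: indicator_def)
      also have "\<dots> = 1/4" by simp
      finally show ?thesis .
    qed
    moreover have "(LINT x|unit_interval_measure. ?b k x *\<^sub>R (1::real)) = integral {0..1} (?b k)" for k
      using integral_continuous_unit_interval[OF test_function_continuous_on[OF test]] by simp
    ultimately have lim: "(\<lambda>k. integral {0..1} (?b k)) \<longlonglongrightarrow> 1/4"
      by (simp only:)
    have "\<exists>k. integral {0..1} (?b k) \<noteq> 0"
    proof (rule ccontr)
      assume "\<nexists>k. integral {0..1} (?b k) \<noteq> 0"
      then have "(\<lambda>k. integral {0..1} (?b k)) = (\<lambda>k. 0)" by blast
      then show False using lim by (simp add: LIMSEQ_const_iff)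
    qed
    then obtain k where "integral {0..1} (?b k) \<noteq> 0" by blast
    with test show thesis by (rule that)
  qed
  define c where "c = (LINT x|unit_interval_measure. \<eta>0 x *\<^sub>R f x) /\<^sub>R integral {0..1} \<eta>0"
  have "AE x in unit_interval_measure. f x - c = 0"
  proof (rule fundamental_lemma_calculus_of_variations)
    show "locally_integrable (\<lambda>x. f x - c)" using f by (intro loc) simp
    fix \<eta> assume \<eta>: "test_function \<eta>"
    define r where "r = integral {0..1} \<eta> / integral {0..1} \<eta>0"
    define \<theta> where "\<theta> = (\<lambda>x. \<eta> x + - r * \<eta>0 x)"
    obtain a b where ab: "0 < a" "a \<le> b" "b < 1" "\<And>x. x \<notin> {a..b} \<Longrightarrow> \<eta> x = 0"
    using test_function_support[OF \<eta>] by metis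
    obtain a0 b0 where ab0: "0 < a0" "a0 \<le> b0" "b0 < 1" "\<And>x. x \<notin> {a0..b0} \<Longrightarrow> \<eta>0 x = 0"
    using test_function_support[OF \<eta>0(1)] by metis
    note int = integrable_continuous_real[OF test_function_continuous_on]
    obtain \<psi> where \<psi>: "test_function \<psi>" "deriv \<psi> = \<theta>"
    proof (rule test_function_primitive)
      show "differentiable_upto n \<theta>" for n
        unfolding \<theta>_def using test_function_differentiable_upto[OF \<eta>]
          test_function_differentiable_upto[OF \<eta>0(1)]
        by (intro differentiable_upto_add differentiable_upto_mult differentiable_upto_const) auto
      show "\<theta> x = 0" if "x \<notin> {min a a0..max b b0}" for x
        using that ab(4)[of x] ab0(4)[of x] by (auto simp: \<theta>_def min_def max_def split: if_splits)
      have "integral {0..1} \<theta> = integral {0..1} \<eta> + integral {0..1} (\<lambda>x. - r * \<eta>0 x)"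
        unfolding \<theta>_def
        by (intro Henstock_Kurzweil_Integration.integral_add integrable_on_mult_right int \<eta> \<eta>0(1))
      also have "integral {0..1} (\<lambda>x. - r * \<eta>0 x) = - r * integral {0..1} \<eta>0"
        by (rule Henstock_Kurzweil_Integration.integral_mult_right)
      finally show "integral {0..1} \<theta> = 0" using \<eta>0(2) by (simp add: r_def)
    qed (use ab ab0 in auto)
    have if1: "integrable unit_interval_measure (\<lambda>x. \<eta> x *\<^sub>R f x)"
      and if2: "integrable unit_interval_measure (\<lambda>x. \<eta>0 x *\<^sub>R f x)"
      and if3: "integrable unit_interval_measure (\<lambda>x. \<eta> x *\<^sub>R c)"
      by (intro integrable_test_function_scaleR \<eta> \<eta>0(1) loc f; simp)+
    have "0 = (LINT x|unit_interval_measure. \<theta> x *\<^sub>R f x)" using weak[OF \<psi>(1)] \<psi>(2) by simp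
    also have "\<dots> = (LINT x|unit_interval_measure. \<eta> x *\<^sub>R f x - r *\<^sub>R \<eta>0 x *\<^sub>R f x)"
      by (simp add: \<theta>_def scaleR_left_diff_distrib)
    also have "\<dots> = (LINT x|unit_interval_measure. \<eta> x *\<^sub>R f x) -
        r *\<^sub>R (LINT x|unit_interval_measure. \<eta>0 x *\<^sub>R f x)"
      using if1 if2 by (simp del: scaleR_scaleR)
    also have "r *\<^sub>R (LINT x|unit_interval_measure. \<eta>0 x *\<^sub>R f x) = integral {0..1} \<eta> *\<^sub>R c"
      by (simp add: r_def c_def divide_inverse)
    also have "\<dots> = (LINT x|unit_interval_measure. \<eta> x *\<^sub>R c)"
      using integral_continuous_unit_interval[OF test_function_continuous_on[OF \<eta>]]
        integrable_test_function_scaleR[OF \<eta>, of "\<lambda>_. 1::real"] by (simp add: loc)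
    finally show "(LINT x|unit_interval_measure. \<eta> x *\<^sub>R (f x - c)) = 0"
      using if1 if3 by (simp add: scaleR_diff_right)
  qed
  then show thesis by (intro that[of c]) simp
qed

section \<open>Primitives\<close>

text \<open>
  The indicator form is defined for all real \<open>x\<close> (constant outside the unit interval) and is the
  shape needed for Fubini.
\<close>

definition primitive :: "(real \<Rightarrow> 'a::euclidean_space) \<Rightarrow> real \<Rightarrow> 'a" where
  "primitive v x = (LINT t|unit_interval_measure. indicator {..x} t *\<^sub>R v t)"

text \<open>
  The half-open interval may be closed, since points are null sets.
\<close>

lemma primitive_diff:
  fixes v :: "real \<Rightarrow> 'a::euclidean_space"
  assumes "integrable unit_interval_measure v" "a \<le> b"
  shows "primitive v b - primitive v a = (LINT t|unit_interval_measure. indicator {a..b} t *\<^sub>R v t)"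
proof -
  have "primitive v b - primitive v a =
      (LINT t|unit_interval_measure. indicator {..b} t *\<^sub>R v t - indicator {..a} t *\<^sub>R v t)"
    unfolding primitive_def using assms(1)
    by (intro Bochner_Integration.integral_diff[symmetric] integrable_indicator_scaleR) auto
  also have "\<dots> = (LINT t|unit_interval_measure. indicator {a<..b} t *\<^sub>R v t)"
    using assms(2) by (intro Bochner_Integration.integral_cong) (auto simp: indicator_def)
  also have "\<dots> = (LINT t|unit_interval_measure. indicator {a..b} t *\<^sub>R v t)"
  proof (rule integral_cong_AE)
    show "AE t in unit_interval_measure. indicator {a<..b} t *\<^sub>R v t = indicator {a..b} t *\<^sub>R v t"
      using AE_unit_interval_neq[of a] by eventually_elim (auto simp: indicator_def)
  qed (intro borel_measurable_integrable integrable_indicator_scaleR assms(1); simp)+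
  finally show ?thesis .
qed

lemma norm_primitive_diff_le:
  fixes v :: "real \<Rightarrow> 'a::euclidean_space"
  assumes v: "integrable unit_interval_measure v" and ab: "a \<le> b"
  shows "norm (primitive v b - primitive v a) \<le>
    primitive (\<lambda>t. norm (v t)) b - primitive (\<lambda>t. norm (v t)) a"
proof -
  have "norm (primitive v b - primitive v a) \<le>
      (LINT t|unit_interval_measure. norm (indicator {a..b} t *\<^sub>R v t))"
    unfolding primitive_diff[OF v ab] by (rule integral_norm_bound)
  also have "\<dots> = (LINT t|unit_interval_measure. indicator {a..b} t *\<^sub>R norm (v t))"
    by (intro Bochner_Integration.integral_cong) (auto simp: indicator_def)
  finally show ?thesis using primitive_diff[OF integrable_norm[OF v] ab] by simp
qed

lemma primitive_eq_0:
  fixes v :: "real \<Rightarrow> 'a::euclidean_space"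
  assumes "x \<le> 0"
  shows "primitive v x = 0"
  unfolding primitive_def
proof (rule integral_eq_zero_AE)
  show "AE t in unit_interval_measure. indicator {..x} t *\<^sub>R v t = 0"
    using AE_unit_interval_neq[of 0] AE_space
    by eventually_elim (use assms in \<open>auto simp: indicator_def\<close>)
qed

lemma primitive_const:
  fixes c :: "'a::euclidean_space"
  assumes "x \<in> {0..1}"
  shows "primitive (\<lambda>_. c) x = x *\<^sub>R c"
proof -
  have "primitive (\<lambda>_. c) x = (LINT t|lebesgue. indicator {0..1} t *\<^sub>R indicator {..x} t *\<^sub>R c)"
    unfolding primitive_def by (subst integral_restrict_space) auto
  also have "\<dots> = (LINT t|lebesgue. indicator {0..x} t *\<^sub>R c)"
    using assms by (intro Bochner_Integration.integral_cong) (auto simp: indicator_def)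
  also have "\<dots> = x *\<^sub>R c" using assms by simp
  finally show ?thesis .
qed

lemma primitive_clamp:
  fixes g :: "real \<Rightarrow> 'a::euclidean_space"
  shows "primitive g (max 0 (min 1 x)) = primitive g x"
proof -
  consider "x \<le> 0" | "0 \<le> x" "x \<le> 1" | "x \<ge> 1" by linarith
  then show ?thesis
  proof cases
    case 3
    then have "primitive g x = primitive g 1"
      unfolding primitive_def by (intro Bochner_Integration.integral_cong) (auto simp: indicator_def)
    with 3 show ?thesis by simp
  qed (auto simp: primitive_eq_0)
qed

lemma continuous_primitive:
  fixes v :: "real \<Rightarrow> 'a::euclidean_space"
  assumes v: "integrable unit_interval_measure v"
  shows "isCont (primitive v) x"
  unfolding continuous_at_sequentially
proof (intro allI impI)
  fix s :: "nat \<Rightarrow> real" assume s: "s \<longlonglongrightarrow> x"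
  show "(primitive v \<circ> s) \<longlonglongrightarrow> primitive v x"
    unfolding o_def primitive_def
  proof (rule integral_dominated_convergence[where w="\<lambda>t. norm (v t)"])
    show "AE t in unit_interval_measure.
        (\<lambda>i. indicator {..s i} t *\<^sub>R v t) \<longlonglongrightarrow> indicator {..x} t *\<^sub>R v t"
      using AE_unit_interval_neq[of x]
    proof eventually_elim
      case (elim t)
      have "\<forall>\<^sub>F i in sequentially. indicator {..s i} t *\<^sub>R v t = indicator {..x} t *\<^sub>R v t"
      proof (cases "t < x")
        case True
        show ?thesis using order_tendstoD(1)[OF s True]
          by eventually_elim (use True in \<open>auto simp: indicator_def\<close>)
      next
        case False
        then have "x < t" using elim by simp
        show ?thesis using order_tendstoD(2)[OF s \<open>x < t\<close>]
          by eventually_elim (use False elim in \<open>auto simp: indicator_def\<close>)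
      qed
      then show ?case by (rule tendsto_eventually)
    qed
    show "integrable unit_interval_measure (\<lambda>t. norm (v t))" using v by simp
    show "(\<lambda>t. indicator {..x} t *\<^sub>R v t) \<in> borel_measurable unit_interval_measure"
      by (intro borel_measurable_integrable integrable_indicator_scaleR v) simp
    show "(\<lambda>t. indicator {..s i} t *\<^sub>R v t) \<in> borel_measurable unit_interval_measure" for i
      by (intro borel_measurable_integrable integrable_indicator_scaleR v) simp
  qed (auto simp: indicator_def)
qed

lemma integrable_primitive:
  fixes v :: "real \<Rightarrow> 'a::euclidean_space"
  assumes v: "integrable unit_interval_measure v"
  shows "integrable unit_interval_measure (primitive v)"
proof -
  have "continuous_on {0..1} (primitive v)"
    using continuous_primitive[OF v] by (intro continuous_at_imp_continuous_on) auto
  then show ?thesis by (rule continuous_imp_integrable_real)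
qed

text \<open>
  Both sides are the double integral of \<open>\<psi>' x * v t\<close> over the triangle \<open>t \<le> x\<close>: integrating first
  over \<open>x \<in> {t..1}\<close> gives \<open>\<psi> 1 - \<psi> t = - \<psi> t\<close>.
\<close>

lemma primitive_integration_by_parts:
  fixes v :: "real \<Rightarrow> 'a::euclidean_space"
  assumes v: "integrable unit_interval_measure v" and \<psi>: "test_function \<psi>"
  shows "(LINT x|unit_interval_measure. deriv \<psi> x *\<^sub>R primitive v x) =
         - (LINT t|unit_interval_measure. \<psi> t *\<^sub>R v t)"
proof -
  interpret finite_measure unit_interval_measure by (rule finite_unit_interval_measure)
  interpret pair_sigma_finite unit_interval_measure unit_interval_measure ..
  note d = test_function_deriv[OF \<psi>]
  obtain B where B: "\<And>x. \<bar>deriv \<psi> x\<bar> \<le> B" using test_function_bounded[OF d] by metis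
  define F :: "real \<Rightarrow> real \<Rightarrow> 'a" where "F x t = (deriv \<psi> x * indicator {..x} t) *\<^sub>R v t" for x t
  have meas: "case_prod F \<in> borel_measurable (unit_interval_measure \<Otimes>\<^sub>M unit_interval_measure)"
  proof -
    have [measurable]: "v \<in> borel_measurable unit_interval_measure" using v by simp
    have [measurable]: "deriv \<psi> \<in> borel_measurable unit_interval_measure"
      using test_function_measurable[OF d] by (rule borel_measurable_unit_interval)
    have [measurable]: "(\<lambda>x. x) \<in> borel_measurable unit_interval_measure"
      by (rule borel_measurable_unit_interval) simp
    have "case_prod F = (\<lambda>z. (deriv \<psi> (fst z) * (if snd z \<le> fst z then 1 else 0)) *\<^sub>R v (snd z))"
      by (auto simp: F_def indicator_def fun_eq_iff)
    also have "\<dots> \<in> borel_measurable (unit_interval_measure \<Otimes>\<^sub>M unit_interval_measure)"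
      by measurable
    finally show ?thesis .
  qed
  have intv: "integrable unit_interval_measure (\<lambda>t. F x t)" for x
    unfolding F_def scaleR_scaleR[symmetric] using v
    by (intro integrable_scaleR_right integrable_indicator_scaleR) auto
  have "integrable (unit_interval_measure \<Otimes>\<^sub>M unit_interval_measure) (case_prod F)"
  proof (rule Fubini_integrable[OF meas])
    show "integrable unit_interval_measure (\<lambda>x. LINT t|unit_interval_measure. norm (case_prod F (x, t)))"
    proof (rule integrable_const_bound)
      show "AE x in unit_interval_measure. norm (LINT t|unit_interval_measure. norm (case_prod F (x, t)))
          \<le> B * (LINT t|unit_interval_measure. norm (v t))"
      proof (rule AE_I2)
        fix x
        have "norm (F x t) \<le> B * norm (v t)" for t
          using B[of x] order_trans[OF abs_ge_zero B[of x]]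
          by (auto simp: F_def indicator_def intro!: mult_right_mono)
        then have "(LINT t|unit_interval_measure. norm (F x t)) \<le>
            (LINT t|unit_interval_measure. B * norm (v t))"
          using v intv by (intro integral_mono) auto
        then show "norm (LINT t|unit_interval_measure. norm (case_prod F (x, t)))
          \<le> B * (LINT t|unit_interval_measure. norm (v t))" by simp
      qed
      show "(\<lambda>x. LINT t|unit_interval_measure. norm (case_prod F (x, t))) \<in>
          borel_measurable unit_interval_measure"
        using meas by measurable
    qed
    show "AE x in unit_interval_measure. integrable unit_interval_measure (\<lambda>t. case_prod F (x, t))"
      using intv by simp
  qed
  from Fubini_integral[OF this]
  have "(LINT x|unit_interval_measure. LINT t|unit_interval_measure. F x t) =
      (LINT t|unit_interval_measure. LINT x|unit_interval_measure. F x t)" by simp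
  moreover have "(LINT t|unit_interval_measure. F x t) = deriv \<psi> x *\<^sub>R primitive v x" for x
    by (simp add: F_def primitive_def flip: scaleR_scaleR)
  moreover have "(LINT x|unit_interval_measure. F x t) = - (\<psi> t *\<^sub>R v t)" if t: "t \<in> {0..1}" for t
  proof -
    have "\<psi> 1 = 0" using test_function_support[OF \<psi>] by (metis atLeastAtMost_iff not_le)
    have "(LINT x|unit_interval_measure. deriv \<psi> x * indicator {..x} t) =
        (LINT x|lebesgue. indicator {0..1} x *\<^sub>R (deriv \<psi> x * indicator {..x} t))"
      by (subst integral_restrict_space) auto
    also have "\<dots> = (LINT x|lebesgue. indicator {t..1} x *\<^sub>R deriv \<psi> x)"
      by (rule Bochner_Integration.integral_cong) (use t in \<open>auto simp: indicator_def\<close>)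
    also have "\<dots> = (LINT x|lebesgue_on {t..1}. deriv \<psi> x)"
      by (subst integral_restrict_space) auto
    also have "\<dots> = integral {t..1} (deriv \<psi>)"
      by (intro lebesgue_integral_eq_integral continuous_imp_integrable_real
          test_function_continuous_on d) auto
    also have "\<dots> = \<psi> 1 - \<psi> t"
    proof (rule integral_unique, rule fundamental_theorem_of_calculus)
      show "(\<psi> has_vector_derivative deriv \<psi> x) (at x within {t..1})" for x
        using test_function_has_derivative[OF \<psi>, of x]
        by (simp add: has_real_derivative_iff_has_vector_derivative has_vector_derivative_at_within)
    qed (use t in auto)
    finally have *: "(LINT x|unit_interval_measure. deriv \<psi> x * indicator {..x} t) = - \<psi> t"
      using \<open>\<psi> 1 = 0\<close> by simp
    have "integrable unit_interval_measure (\<lambda>x. indicator {t..} x *\<^sub>R deriv \<psi> x)"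
      by (intro integrable_indicator_scaleR continuous_imp_integrable_real test_function_continuous_on d) auto
    also have "(\<lambda>x. indicator {t..} x *\<^sub>R deriv \<psi> x) = (\<lambda>x. deriv \<psi> x * indicator {..x} t)"
      by (auto simp: indicator_def fun_eq_iff)
    finally show ?thesis using * by (simp add: F_def)
  qed
  then have "(LINT t|unit_interval_measure. LINT x|unit_interval_measure. F x t) =
      (LINT t|unit_interval_measure. - (\<psi> t *\<^sub>R v t))"
    by (intro Bochner_Integration.integral_cong) auto
  ultimately show ?thesis by simp
qed

lemma has_weak_deriv_primitive:
  fixes u v :: "real \<Rightarrow> 'a::euclidean_space"
  assumes v: "integrable unit_interval_measure v" and u: "u \<in> borel_measurable unit_interval_measure"
    and eq: "AE x in unit_interval_measure. u x = c + primitive v x"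
  shows "has_weak_deriv u v"
  unfolding has_weak_deriv_def
proof (intro conjI allI impI)
  interpret finite_measure unit_interval_measure by (rule finite_unit_interval_measure)
  note prim = integrable_primitive[OF v]
  have "integrable unit_interval_measure (\<lambda>x. c + primitive v x)" using prim by simp
  then have "integrable unit_interval_measure u"
    using integrable_cong_AE[OF u _ eq] prim by (simp add: borel_measurable_integrable)
  then show "locally_integrable u" by (rule integrable_imp_locally_integrable)
  show "locally_integrable v" using v by (rule integrable_imp_locally_integrable)
  fix \<psi> assume \<psi>: "test_function \<psi>"
  note d = test_function_deriv[OF \<psi>]
  have int: "integrable unit_interval_measure (\<lambda>x. deriv \<psi> x *\<^sub>R f x)" if "locally_integrable f"
    for f :: "real \<Rightarrow> 'a" by (rule integrable_test_function_scaleR[OF d that])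
  have int1: "integrable unit_interval_measure (\<lambda>x. deriv \<psi> x *\<^sub>R c)"
    and int2: "integrable unit_interval_measure (\<lambda>x. deriv \<psi> x *\<^sub>R primitive v x)"
    and int3: "integrable unit_interval_measure (\<lambda>x. deriv \<psi> x *\<^sub>R u x)"
    using prim \<open>locally_integrable u\<close> by (auto intro!: int integrable_imp_locally_integrable)
  have intd: "integrable unit_interval_measure (deriv \<psi>)"
    by (intro continuous_imp_integrable_real test_function_continuous_on d)
  have "(LINT x|unit_interval_measure. deriv \<psi> x *\<^sub>R u x) =
      (LINT x|unit_interval_measure. deriv \<psi> x *\<^sub>R c + deriv \<psi> x *\<^sub>R primitive v x)"
  proof (rule integral_cong_AE)
    show "AE x in unit_interval_measure. deriv \<psi> x *\<^sub>R u x = deriv \<psi> x *\<^sub>R c + deriv \<psi> x *\<^sub>R primitive v x"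
      using eq by eventually_elim (simp add: scaleR_add_right)
  qed (use int1 int2 int3 in \<open>auto intro!: borel_measurable_add intro: borel_measurable_integrable\<close>)
  also have "\<dots> = (LINT x|unit_interval_measure. deriv \<psi> x *\<^sub>R c) +
      (LINT x|unit_interval_measure. deriv \<psi> x *\<^sub>R primitive v x)"
    using int1 int2 by (rule Bochner_Integration.integral_add)
  also have "(LINT x|unit_interval_measure. deriv \<psi> x *\<^sub>R c) = 0"
    using integral_deriv_test_function[OF \<psi>] intd by simp
  finally show "(LINT x|unit_interval_measure. deriv \<psi> x *\<^sub>R u x) =
      - (LINT x|unit_interval_measure. \<psi> x *\<^sub>R v x)"
    using primitive_integration_by_parts[OF v \<psi>] by simp
qed

text \<open>
  The difference of \<open>u\<close> and the primitive of \<open>v\<close> has weak derivative zero.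
\<close>

lemma has_weak_deriv_imp_primitive:
  fixes u v :: "real \<Rightarrow> 'a::euclidean_space"
  assumes u: "integrable unit_interval_measure u" and v: "integrable unit_interval_measure v"
    and weak: "has_weak_deriv u v"
  shows "\<exists>c. AE x in unit_interval_measure. u x = c + primitive v x"
proof -
  note prim = integrable_primitive[OF v]
  obtain c where "AE x in unit_interval_measure. u x - primitive v x = c"
  proof (rule du_Bois_Reymond[of "\<lambda>x. u x - primitive v x"])
    show "integrable unit_interval_measure (\<lambda>x. u x - primitive v x)" using u prim by simp
    fix \<psi> assume \<psi>: "test_function \<psi>"
    note d = test_function_deriv[OF \<psi>]
    have "integrable unit_interval_measure (\<lambda>x. deriv \<psi> x *\<^sub>R u x)"
      "integrable unit_interval_measure (\<lambda>x. deriv \<psi> x *\<^sub>R primitive v x)"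
      using u prim by (auto intro!: integrable_test_function_scaleR[OF d] integrable_imp_locally_integrable)
    from Bochner_Integration.integral_diff[OF this]
    show "(LINT x|unit_interval_measure. deriv \<psi> x *\<^sub>R (u x - primitive v x)) = 0"
      using primitive_integration_by_parts[OF v \<psi>] weak \<psi>
      by (simp add: scaleR_diff_right has_weak_deriv_def)
  qed
  then have "AE x in unit_interval_measure. u x = c + primitive v x"
    by (auto elim!: eventually_mono simp: algebra_simps)
  then show ?thesis by blast
qed

section \<open>Functions with dominated increments\<close>

lemma AE_lborel_imp_AE_unit_interval:
  "AE x in lborel. P x \<Longrightarrow> AE x in unit_interval_measure. P x"
  by (subst AE_restrict_space_iff) (auto dest: AE_completion)

lemma unit_interval_integral_eq_lborel:
  fixes r :: "real \<Rightarrow> real"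
  assumes "integrable lborel r"
  shows "integrable unit_interval_measure r"
    and "0 \<le> a \<Longrightarrow> b \<le> 1 \<Longrightarrow> (LINT x|unit_interval_measure. indicator {a..b} x *\<^sub>R r x) =
      (LINT x|lborel. indicator {a..b} x *\<^sub>R r x)"
proof -
  have "integrable lebesgue (\<lambda>x. indicator {0..1} x *\<^sub>R r x)"
    using assms by (intro integrable_mult_indicator) (auto simp: integrable_completion borel_measurable_integrable)
  then show "integrable unit_interval_measure r" by (subst integrable_restrict_space) auto
  assume ab: "0 \<le> a" "b \<le> 1"
  have "(LINT x|unit_interval_measure. indicator {a..b} x *\<^sub>R r x) =
      (LINT x|lebesgue. indicator {0..1} x *\<^sub>R indicator {a..b} x *\<^sub>R r x)"
    by (subst integral_restrict_space) auto
  also have "\<dots> = (LINT x|lebesgue. indicator {a..b} x *\<^sub>R r x)"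
    using ab by (intro Bochner_Integration.integral_cong) (auto simp: indicator_def)
  also have "\<dots> = (LINT x|lborel. indicator {a..b} x *\<^sub>R r x)"
    using assms by (intro integral_completion) simp
  finally show "(LINT x|unit_interval_measure. indicator {a..b} x *\<^sub>R r x) =
      (LINT x|lborel. indicator {a..b} x *\<^sub>R r x)" .
qed

text \<open>
  The Radon-Nikodym theorem in terms of real integrals; finiteness of \<open>N\<close> makes the density
  integrable.
\<close>

lemma finite_borel_measure_real_density:
  assumes N: "finite_measure N" "sets N = sets borel" and ac: "absolutely_continuous lborel N"
  shows "\<exists>r :: real \<Rightarrow> real. integrable lborel r \<and> (\<forall>x. 0 \<le> r x) \<and>
    (\<forall>A\<in>sets borel. measure N A = (LINT x|lborel. indicator A x *\<^sub>R r x))"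
proof -
  interpret N: finite_measure N by (rule N(1))
  obtain r where r: "r \<in> borel_measurable lborel" "AE x in lborel. RN_deriv lborel N x = ennreal (r x)"
    "\<And>x. 0 \<le> r x"
    using sigma_finite_measure.real_RN_deriv[OF sigma_finite_lborel N(1) ac] N(2) by (metis sets_lborel)
  have em: "emeasure N A = (\<integral>\<^sup>+x. ennreal (indicator A x *\<^sub>R r x) \<partial>lborel)" if "A \<in> sets borel" for A
  proof -
    have "emeasure N A = emeasure (density lborel (RN_deriv lborel N)) A"
      using sigma_finite_measure.density_RN_deriv[OF sigma_finite_lborel ac] N(2) by simp
    also have "\<dots> = (\<integral>\<^sup>+x. RN_deriv lborel N x * indicator A x \<partial>lborel)"
      using that by (simp add: emeasure_density)
    also have "\<dots> = (\<integral>\<^sup>+x. ennreal (indicator A x *\<^sub>R r x) \<partial>lborel)"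
      using r(2) by (intro nn_integral_cong_AE, eventually_elim) (auto simp: indicator_def)
    finally show ?thesis .
  qed
  show ?thesis
  proof (intro exI[of _ r] conjI ballI allI)
    have "(\<integral>\<^sup>+x. ennreal (r x) \<partial>lborel) < \<infinity>"
      using em[of UNIV] N.emeasure_finite[of UNIV] by (simp add: less_top)
    then show int: "integrable lborel r" using r by (intro integrableI_nonneg) auto
    fix A :: "real set" assume A: "A \<in> sets borel"
    have "integrable lborel (\<lambda>x. indicator A x *\<^sub>R r x)" using A int by (intro integrable_mult_indicator) auto
    then have "emeasure N A = ennreal (LINT x|lborel. indicator A x *\<^sub>R r x)"
      using em[OF A] r(3) by (subst nn_integral_eq_integral[symmetric]) auto
    then show "measure N A = (LINT x|lborel. indicator A x *\<^sub>R r x)"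
      unfolding measure_def using r(3) by simp
  qed (rule r(3))
qed

text \<open>
  Let \<open>G\<close> be the primitive of \<open>g\<close>. The hypothesis says that \<open>G + w\<close> is nondecreasing, and it
  transfers the continuity of \<open>G\<close> to \<open>w\<close>; the measure is the one with this distribution function.
  Freezing \<open>w\<close> outside the unit interval makes this function monotone on the whole line, and restricting the measure to
  the unit interval makes it finite.
\<close>

lemma dominated_increments_measure:
  fixes w g :: "real \<Rightarrow> real"
  assumes g: "integrable unit_interval_measure g"
    and w: "\<And>a b. 0 \<le> a \<Longrightarrow> a \<le> b \<Longrightarrow> b \<le> 1 \<Longrightarrow>
      \<bar>w b - w a\<bar> \<le> (LINT t|unit_interval_measure. indicator {a..b} t *\<^sub>R g t)"
  shows "\<exists>N. finite_measure N \<and> sets N = sets borel \<and>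
    (\<forall>A\<in>sets borel. measure N A = measure N (A \<inter> {0..1})) \<and>
    (\<forall>a b. 0 \<le> a \<and> a \<le> b \<and> b \<le> 1 \<longrightarrow>
      measure N {a..b} = (LINT t|unit_interval_measure. indicator {a..b} t *\<^sub>R g t) + (w b - w a))"
proof -
  define c :: "real \<Rightarrow> real" where "c x = max 0 (min 1 x)" for x
  define F where "F x = primitive g x + w (c x)" for x
  have incr: "\<bar>w (c y) - w (c x)\<bar> \<le> primitive g y - primitive g x" if "x \<le> y" for x y
  proof -
    have "c x \<le> c y" "0 \<le> c x" "c y \<le> 1" using that by (auto simp: c_def)
    moreover have "primitive g (c z) = primitive g z" for z unfolding c_def by (rule primitive_clamp)
    ultimately show ?thesis
      using w[of "c x" "c y"] primitive_diff[OF g, of "c x" "c y"] by simp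
  qed
  have mono: "F x \<le> F y" if "x \<le> y" for x y
    using incr[OF that] by (simp add: F_def)
  have cont: "isCont F x" for x
  proof -
    have "((\<lambda>y. w (c y) - w (c x)) \<longlongrightarrow> 0) (at x)"
    proof (rule Lim_null_comparison[where g="\<lambda>y. \<bar>primitive g y - primitive g x\<bar>"])
      have "norm (w (c y) - w (c x)) \<le> \<bar>primitive g y - primitive g x\<bar>" for y
        using incr[of x y] incr[of y x] by (cases "x \<le> y") auto
      then show "\<forall>\<^sub>F y in at x. norm (w (c y) - w (c x)) \<le> \<bar>primitive g y - primitive g x\<bar>"
        by simp
      show "((\<lambda>y. \<bar>primitive g y - primitive g x\<bar>) \<longlongrightarrow> 0) (at x)"
        using continuous_primitive[OF g, of x] by (intro tendsto_rabs_zero LIM_zero) (simp add: isCont_def)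
    qed
    then have "isCont (\<lambda>y. w (c y)) x" by (simp add: isCont_def LIM_zero_iff)
    then show ?thesis unfolding F_def using continuous_primitive[OF g] by (intro isCont_add) 
  qed
  then have contU: "continuous_on UNIV F" by (simp add: continuous_at_imp_continuous_on)
  define N where "N = density (interval_measure F) (indicator {0..1})"
  have em: "emeasure N A = emeasure (interval_measure F) ({0..1} \<inter> A)" if "A \<in> sets borel" for A
    unfolding N_def using that by (intro emeasure_restricted) auto
  have Icc: "emeasure N {a..b} = ennreal (F b - F a)" if "0 \<le> a" "a \<le> b" "b \<le> 1" for a b
  proof -
    have "{0..1} \<inter> {a..b} = {a..b}" using that by auto
    then show ?thesis using that em[of "{a..b}"] by (simp add: emeasure_interval_measure_Icc mono contU)
  qed
  show ?thesis
  proof (intro exI[of _ N] conjI ballI allI impI)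
    show sets: "sets N = sets borel" by (simp add: N_def)
    show "finite_measure N"
    proof
      have "emeasure N (space N) = emeasure N {0..1}"
        using em[of UNIV] em[of "{0..1}"] by (simp add: N_def)
      then show "emeasure N (space N) \<noteq> \<infinity>" using Icc[of 0 1] by simp
    qed
    show "measure N A = measure N (A \<inter> {0..1})" if "A \<in> sets borel" for A
      using that em[of A] em[of "A \<inter> {0..1}"] by (simp add: measure_def Int_ac)
    fix a b :: real assume "0 \<le> a \<and> a \<le> b \<and> b \<le> 1"
    then have ab: "0 \<le> a" "a \<le> b" "b \<le> 1" by auto
    then have "measure N {a..b} = F b - F a" using Icc[OF ab] mono[OF ab(2)] by (simp add: measure_def)
    also have "\<dots> = (LINT t|unit_interval_measure. indicator {a..b} t *\<^sub>R g t) + (w b - w a)"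
      using ab primitive_diff[OF g ab(2)] by (simp add: F_def c_def)
    finally show "measure N {a..b} =
        (LINT t|unit_interval_measure. indicator {a..b} t *\<^sub>R g t) + (w b - w a)" .
  qed
qed

text \<open>
  The measures \<open>P\<close> and \<open>Q\<close> belonging to \<open>w\<close> and \<open>-w\<close> have sum \<open>2g\<close> on intervals, hence on all Borel sets,
  so both are absolutely continuous. Their densities \<open>r\<close> and \<open>s\<close> are nonnegative and satisfy
  \<open>r + s = 2g\<close>, whence \<open>\<bar>r - s\<bar> / 2 \<le> g\<close>.
\<close>

lemma dominated_increments_imp_primitive:
  fixes w g :: "real \<Rightarrow> real"
  assumes g: "integrable unit_interval_measure g"
    and w: "\<And>a b. 0 \<le> a \<Longrightarrow> a \<le> b \<Longrightarrow> b \<le> 1 \<Longrightarrow>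
      \<bar>w b - w a\<bar> \<le> (LINT t|unit_interval_measure. indicator {a..b} t *\<^sub>R g t)"
  shows "\<exists>v. integrable unit_interval_measure v \<and>
    (AE x in unit_interval_measure. \<bar>v x\<bar> \<le> g x) \<and> (\<forall>x\<in>{0..1}. w x = w 0 + primitive v x)"
proof -
  let ?J = "\<lambda>A h. LINT t|unit_interval_measure. indicator A t *\<^sub>R h t"
  obtain P where P: "finite_measure P" "sets P = sets borel" "\<forall>A\<in>sets borel. measure P A = measure P (A \<inter> {0..1})"
    "\<forall>a b. 0 \<le> a \<and> a \<le> b \<and> b \<le> 1 \<longrightarrow> measure P {a..b} = ?J {a..b} g + (w b - w a)"
    using dominated_increments_measure[OF g w] by blast
  obtain Q where Q: "finite_measure Q" "sets Q = sets borel" "\<forall>A\<in>sets borel. measure Q A = measure Q (A \<inter> {0..1})"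
    "\<forall>a b. 0 \<le> a \<and> a \<le> b \<and> b \<le> 1 \<longrightarrow> measure Q {a..b} = ?J {a..b} g + (- w b - - w a)"
  proof -
    have "\<bar>- w b - - w a\<bar> \<le> ?J {a..b} g" if "0 \<le> a" "a \<le> b" "b \<le> 1" for a b
      using w[OF that] by (simp add: abs_minus_commute)
    from dominated_increments_measure[OF g this] show thesis using that by blast
  qed
  interpret P: finite_measure P by (rule P(1))
  interpret Q: finite_measure Q by (rule Q(1))
  have space: "space P = UNIV" "space Q = UNIV"
    using P(2) Q(2) by (auto dest: sets_eq_imp_space_eq)
  have sum: "measure P A + measure Q A = 2 * ?J A g" if "A \<in> sets borel" for A
    using that
  proof (induction A rule: borel_set_induct)
    case (interval a b)
    define a' b' where "a' = max a 0" and "b' = min b 1"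
    have eq: "{a..b} \<inter> {0..1} = {a'..b'}" and a': "0 \<le> a'" and b': "b' \<le> 1"
      by (auto simp: a'_def b'_def)
    have "?J {a..b} g = ?J {a'..b'} g"
      by (rule Bochner_Integration.integral_cong) (auto simp: indicator_def a'_def b'_def)
    moreover have "measure P {a..b} = measure P {a'..b'}" "measure Q {a..b} = measure Q {a'..b'}"
      using bspec[OF P(3), of "{a..b}"] bspec[OF Q(3), of "{a..b}"] unfolding eq by simp_all
    moreover have "measure P {a'..b'} + measure Q {a'..b'} = 2 * ?J {a'..b'} g"
    proof (cases "a' \<le> b'")
      case True
      then show ?thesis using P(4)[rule_format, of a' b'] Q(4)[rule_format, of a' b'] a' b' by simp
    qed simp
    ultimately show ?case by simp
  next
    case (compl A)
    have "?J UNIV g = ?J {0..1} g"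
      by (rule Bochner_Integration.integral_cong) (auto simp: indicator_def)
    moreover have "measure P UNIV = ?J {0..1} g + (w 1 - w 0)" "measure Q UNIV = ?J {0..1} g - (w 1 - w 0)"
      using bspec[OF P(3), of UNIV] bspec[OF Q(3), of UNIV] P(4)[rule_format, of 0 1] Q(4)[rule_format, of 0 1]
      by simp_all
    ultimately have "measure P UNIV + measure Q UNIV = 2 * ?J UNIV g" by linarith
    then show ?case
      using P.finite_measure_compl[of A] Q.finite_measure_compl[of A] compl space P(2) Q(2)
        integral_Compl_borel[OF g, of A] by (simp add: Compl_eq_Diff_UNIV)
  next
    case (union A)
    have "(\<lambda>i. measure P (A i) + measure Q (A i)) sums (measure P (\<Union>i. A i) + measure Q (\<Union>i. A i))"
      using union P(2) Q(2) by (intro sums_add P.finite_measure_UNION Q.finite_measure_UNION) auto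
    then have S: "(\<lambda>i. 2 * ?J (A i) g) sums (measure P (\<Union>i. A i) + measure Q (\<Union>i. A i))"
      using union by simp
    then have "(\<lambda>i. ?J (A i) g) sums ((measure P (\<Union>i. A i) + measure Q (\<Union>i. A i)) / 2)"
      using sums_divide[OF S, of 2] by simp
    moreover have "?J (\<Union>i. A i) g = (\<Sum>i. ?J (A i) g)"
      using union by (intro integral_UN_disjoint_borel[OF g])
    ultimately show ?case using sums_unique by fastforce
  qed simp
  have null: "measure P A = 0 \<and> measure Q A = 0" if "A \<in> null_sets lborel" for A
  proof -
    have "AE x in unit_interval_measure. x \<notin> A"
      using that by (intro AE_lborel_imp_AE_unit_interval AE_not_in)
    then have "?J A g = 0" by (intro integral_eq_zero_AE, eventually_elim) simp
    moreover have "A \<in> sets borel" using that by (auto simp: null_sets_def)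
    ultimately show ?thesis
      using sum[of A] measure_nonneg[of P A] measure_nonneg[of Q A] by linarith
  qed
  have "absolutely_continuous lborel P" "absolutely_continuous lborel Q"
    using null P(2) Q(2)
    by (auto simp: absolutely_continuous_def null_sets_def P.emeasure_eq_measure Q.emeasure_eq_measure)
  then obtain r s where r: "integrable lborel r" "\<forall>x. 0 \<le> r x"
      "\<forall>A\<in>sets borel. measure P A = (LINT x|lborel. indicator A x *\<^sub>R r x)"
    and s: "integrable lborel s" "\<forall>x. 0 \<le> s x"
      "\<forall>A\<in>sets borel. measure Q A = (LINT x|lborel. indicator A x *\<^sub>R s x)"
    using finite_borel_measure_real_density[OF P(1,2)] finite_borel_measure_real_density[OF Q(1,2)]
    by blast
  note rM = unit_interval_integral_eq_lborel(1)[OF r(1)] and sM = unit_interval_integral_eq_lborel(1)[OF s(1)]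
  have J: "?J {a..b} r = ?J {a..b} g + (w b - w a)" "?J {a..b} s = ?J {a..b} g - (w b - w a)"
    if "0 \<le> a" "a \<le> b" "b \<le> 1" for a b
    using unit_interval_integral_eq_lborel(2)[OF r(1) that(1,3)] unit_interval_integral_eq_lborel(2)[OF s(1) that(1,3)]
      bspec[OF r(3), of "{a..b}"] bspec[OF s(3), of "{a..b}"] P(4)[rule_format, of a b] Q(4)[rule_format, of a b] that by simp_all
  have Jint: "integrable unit_interval_measure (\<lambda>t. indicator {a..b} t *\<^sub>R r t)"
     "integrable unit_interval_measure (\<lambda>t. indicator {a..b} t *\<^sub>R s t)"
     "integrable unit_interval_measure (\<lambda>t. indicator {a..b} t *\<^sub>R g t)" for a b
    by (intro integrable_indicator_scaleR rM sM g; simp)+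
  have AE: "AE x in unit_interval_measure. r x + s x - 2 * g x = 0"
  proof (rule AE_eq_0_if_interval_integrals_eq_0)
    show "integrable unit_interval_measure (\<lambda>x. r x + s x - 2 * g x)" using rM sM g by simp
    fix a b :: real assume ab: "0 \<le> a" "a \<le> b" "b \<le> 1"
    have "?J {a..b} (\<lambda>x. r x + s x - 2 * g x) =
        (LINT t|unit_interval_measure. indicator {a..b} t *\<^sub>R r t + indicator {a..b} t *\<^sub>R s t -
          2 * (indicator {a..b} t *\<^sub>R g t))"
      by (simp add: algebra_simps)
    also have "\<dots> = ?J {a..b} r + ?J {a..b} s -
        (LINT t|unit_interval_measure. 2 * (indicator {a..b} t *\<^sub>R g t))"
      by (subst Bochner_Integration.integral_diff)
        (intro Bochner_Integration.integrable_add integrable_mult_right Jint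
          Bochner_Integration.integral_add arg_cong2[where f="(-)"] refl)+
    also have "\<dots> = ?J {a..b} r + ?J {a..b} s - 2 * ?J {a..b} g"
      by (simp only: integral_mult_right_zero)
    finally show "?J {a..b} (\<lambda>x. r x + s x - 2 * g x) = 0" using J[OF ab] by simp
  qed
  show ?thesis
  proof (intro exI[of _ "\<lambda>x. (r x - s x) / 2"] conjI ballI)
    show v: "integrable unit_interval_measure (\<lambda>x. (r x - s x) / 2)" using rM sM by simp
    show "AE x in unit_interval_measure. \<bar>(r x - s x) / 2\<bar> \<le> g x"
      using AE
    proof eventually_elim
      case (elim x)
      then show ?case using spec[OF r(2), of x] spec[OF s(2), of x] by (simp add: abs_le_iff field_simps)
    qed
    fix x :: real assume x: "x \<in> {0..1}"
    have "primitive (\<lambda>x. (r x - s x) / 2) x = ?J {0..x} (\<lambda>x. (r x - s x) / 2)"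
      using primitive_diff[OF v, of 0 x] x by (simp add: primitive_eq_0)
    also have "\<dots> = (LINT t|unit_interval_measure. (indicator {0..x} t *\<^sub>R r t - indicator {0..x} t *\<^sub>R s t) / 2)"
      by (simp add: algebra_simps diff_divide_distrib)
    also have "\<dots> = (?J {0..x} r - ?J {0..x} s) / 2"
      using Jint[of 0 x] by (simp del: real_scaleR_def)
    also have "\<dots> = w x - w 0" using J[of 0 x] x by simp
    finally show "w x = w 0 + primitive (\<lambda>x. (r x - s x) / 2) x" by simp
  qed
qed

section \<open>The Lipschitz chain rule and boundedness\<close>

lemma Lp_space_imp_integrable:
  fixes u :: "real \<Rightarrow> 'a::euclidean_space"
  assumes "u \<in> Lp_space p" "1 \<le> p"
  shows "integrable unit_interval_measure u"
proof (rule Bochner_Integration.integrable_bound)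
  interpret finite_measure unit_interval_measure by (rule finite_unit_interval_measure)
  show "integrable unit_interval_measure (\<lambda>x. 1 + norm (u x) powr p)"
    using assms(1) by (simp add: Lp_space_def)
  show "u \<in> borel_measurable unit_interval_measure" using assms(1) by (simp add: Lp_space_def)
  have "norm (u x) \<le> 1 + norm (u x) powr p" for x
  proof (cases "norm (u x) \<le> 1")
    case True
    then show ?thesis by (smt (verit) powr_ge_zero)
  next
    case False
    then have "norm (u x) powr 1 \<le> norm (u x) powr p" using assms(2) by (intro powr_mono) auto
    with False show ?thesis by simp
  qed
  then show "AE x in unit_interval_measure. norm (u x) \<le> norm (1 + norm (u x) powr p)"
    by (intro AE_I2) (smt (verit) real_norm_def)
qed

lemma Lp_norm_nonneg: "0 \<le> Lp_norm p u"
  by (simp add: Lp_norm_def)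

text \<open>
  Up to the factor 2 this is the inequality between the \<open>L\<^sup>1\<close> and the \<open>L\<^sup>p\<close> norm on a probability space.
  The pointwise bound \<open>t \<le> c + c\<^sup>1\<^sup>-\<^sup>p t\<^sup>p\<close> replaces the Hoelder inequality and covers \<open>p = 1\<close> uniformly.
\<close>

lemma Lp_norm_ge_half_mean:
  fixes z :: "real \<Rightarrow> 'a::euclidean_space"
  assumes z: "z \<in> Lp_space p" and p: "1 \<le> p" and c: "0 < c"
    and mean: "2 * c \<le> (LINT x|unit_interval_measure. norm (z x))"
  shows "c \<le> Lp_norm p z"
proof -
  interpret finite_measure unit_interval_measure by (rule finite_unit_interval_measure)
  let ?I = "LINT x|unit_interval_measure. norm (z x) powr p"
  have int: "integrable unit_interval_measure (\<lambda>x. norm (z x) powr p)"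
    using z by (simp add: Lp_space_def)
  have m1: "measure unit_interval_measure {0..1} = 1" by (subst measure_restrict_space) auto
  have young: "t \<le> c + c powr (1 - p) * t powr p" if "0 \<le> t" for t
  proof (cases "t \<le> c")
    case True
    have "0 \<le> c powr (1 - p) * t powr p" by simp
    with True show ?thesis by linarith
  next
    case False
    then have "(t / c) powr 1 \<le> (t / c) powr p" using c p by (intro powr_mono) auto
    then have "c * (t / c) \<le> c * (t powr p / c powr p)"
      using c that by (intro mult_left_mono) (auto simp: powr_divide)
    also have "\<dots> = c powr (1 - p) * t powr p" using c by (simp add: powr_diff)
    finally show ?thesis using c by simp
  qed
  have "2 * c \<le> (LINT x|unit_interval_measure. c + c powr (1 - p) * norm (z x) powr p)"
    using mean
  proof (rule order_trans)
    show "(LINT x|unit_interval_measure. norm (z x)) \<le>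
        (LINT x|unit_interval_measure. c + c powr (1 - p) * norm (z x) powr p)"
      using young int Lp_space_imp_integrable[OF z p] by (intro integral_mono) auto
  qed
  also have "\<dots> = c + c powr (1 - p) * ?I" using int m1 by simp
  finally have "c powr p * c \<le> c powr p * (c powr (1 - p) * ?I)" using c by (intro mult_left_mono) auto
  also have "\<dots> = c * ?I" using c by (simp add: powr_diff)
  finally have "c powr p \<le> ?I" using c by (simp add: mult.commute)
  then have "(c powr p) powr (1 / p) \<le> ?I powr (1 / p)" using p by (intro powr_mono2) auto
  then show ?thesis using p c by (simp add: Lp_norm_def powr_powr)
qed

lemma Lp_norm_cong_AE:
  fixes u v :: "real \<Rightarrow> 'a::euclidean_space"
  assumes "u \<in> borel_measurable unit_interval_measure" "v \<in> borel_measurable unit_interval_measure"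
    and "AE x in unit_interval_measure. u x = v x"
  shows "Lp_norm p u = Lp_norm p v"
proof -
  have "(LINT x|unit_interval_measure. norm (u x) powr p) =
      (LINT x|unit_interval_measure. norm (v x) powr p)"
    using assms by (intro integral_cong_AE) auto
  then show ?thesis by (simp add: Lp_norm_def)
qed

lemma Lp_dominated:
  fixes v :: "real \<Rightarrow> 'a::euclidean_space" and z :: "real \<Rightarrow> 'b::euclidean_space"
  assumes v: "v \<in> Lp_space p" and p: "1 \<le> p" and L: "0 \<le> L"
    and z: "z \<in> borel_measurable unit_interval_measure"
    and le: "AE x in unit_interval_measure. norm (z x) \<le> L * norm (v x)"
  shows "z \<in> Lp_space p" "Lp_norm p z \<le> L * Lp_norm p v"
proof -
  have int: "integrable unit_interval_measure (\<lambda>x. L powr p * norm (v x) powr p)"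
    using v by (simp add: Lp_space_def)
  have le': "AE x in unit_interval_measure. norm (z x) powr p \<le> L powr p * norm (v x) powr p"
    using le
  proof eventually_elim
    case (elim x)
    then have "norm (z x) powr p \<le> (L * norm (v x)) powr p" using p by (intro powr_mono2) auto
    then show ?case using L by (simp add: powr_mult)
  qed
  have intz: "integrable unit_interval_measure (\<lambda>x. norm (z x) powr p)"
    by (rule Bochner_Integration.integrable_bound[OF int]) (use z le' in auto)
  then show "z \<in> Lp_space p" using z by (simp add: Lp_space_def)
  have "(LINT x|unit_interval_measure. norm (z x) powr p) \<le>
      (LINT x|unit_interval_measure. L powr p * norm (v x) powr p)"
    using intz int le' by (rule integral_mono_AE)
  then have "Lp_norm p z \<le> (L powr p * (LINT x|unit_interval_measure. norm (v x) powr p)) powr (1 / p)"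
    unfolding Lp_norm_def using p by (intro powr_mono2) (auto intro!: integral_nonneg_AE)
  also have "\<dots> = L * Lp_norm p v"
    using L p by (simp add: powr_mult powr_powr Lp_norm_def)
  finally show "Lp_norm p z \<le> L * Lp_norm p v" .
qed

lemma const_in_Lp_space:
  fixes c :: "'a::euclidean_space"
  assumes "1 \<le> p"
  shows "(\<lambda>x. c) \<in> Lp_space p" "Lp_norm p (\<lambda>x. c) = norm c"
proof -
  interpret finite_measure unit_interval_measure by (rule finite_unit_interval_measure)
  have "measure unit_interval_measure {0..1} = 1"
    by (subst measure_restrict_space) auto
  then show "Lp_norm p (\<lambda>x. c) = norm c" using assms by (simp add: Lp_norm_def powr_powr)
  show "(\<lambda>x. c) \<in> Lp_space p" by (simp add: Lp_space_def)
qed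

text \<open>
  Uniqueness of weak derivatives allows norms to be computed with any of them instead of the chosen
  one, of which only local integrability is known beforehand.
\<close>

lemma Lp_norm_weak_deriv:
  fixes u :: "real \<Rightarrow> 'a::euclidean_space"
  assumes "has_weak_deriv u v"
  shows "Lp_norm p (weak_deriv u) = Lp_norm p v"
proof -
  have w: "has_weak_deriv u (weak_deriv u)" unfolding weak_deriv_def
    by (rule someI[of "has_weak_deriv u", OF assms])
  then have "AE x in unit_interval_measure. weak_deriv u x = v x"
    using assms by (rule has_weak_deriv_unique)
  then show ?thesis
    using w assms by (intro Lp_norm_cong_AE locally_integrable_measurable) (auto simp: has_weak_deriv_def)
qed

text \<open>
  Increments of \<open>\<phi> \<circ> u\<close> are at most \<open>L\<close> times those of \<open>u\<close>, which are integrals of \<open>v\<close>. The last part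
  of the conclusion holds at every point, not only almost everywhere; it is what allows the
  variation of \<open>\<phi> \<circ> u\<close> to be read off from its values.
\<close>

lemma Lipschitz_chain_rule:
  fixes u v :: "real \<Rightarrow> 'a::euclidean_space" and \<phi> :: "'a \<Rightarrow> real"
  assumes Lip: "L-lipschitz_on UNIV \<phi>" and u: "u \<in> borel_measurable unit_interval_measure"
    and v: "integrable unit_interval_measure v"
    and eq: "AE x in unit_interval_measure. u x = c + primitive v x"
  shows "\<exists>z. integrable unit_interval_measure z \<and> has_weak_deriv (\<phi> \<circ> u) z \<and>
    (AE x in unit_interval_measure. \<bar>z x\<bar> \<le> L * norm (v x)) \<and>
    (\<forall>x\<in>{0..1}. \<phi> (c + primitive v x) = \<phi> c + primitive z x)"
proof -
  define w where "w x = \<phi> (c + primitive v x)" for x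
  have L: "0 \<le> L" using Lip by (rule lipschitz_on_nonneg)
  have "\<bar>w b - w a\<bar> \<le> (LINT t|unit_interval_measure. indicator {a..b} t *\<^sub>R (L * norm (v t)))"
    if "0 \<le> a" "a \<le> b" "b \<le> 1" for a b
  proof -
    have "\<bar>w b - w a\<bar> \<le> L * norm (primitive v b - primitive v a)"
      using lipschitz_onD[OF Lip, of "c + primitive v b" "c + primitive v a"]
      by (simp add: w_def dist_norm)
    also have "\<dots> \<le> L * (primitive (\<lambda>t. norm (v t)) b - primitive (\<lambda>t. norm (v t)) a)"
      using L norm_primitive_diff_le[OF v that(2)] by (rule mult_left_mono[rotated])
    also have "\<dots> = L * (LINT t|unit_interval_measure. indicator {a..b} t *\<^sub>R norm (v t))"
      using primitive_diff[OF integrable_norm[OF v] that(2)] by simp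
    also have "\<dots> = (LINT t|unit_interval_measure. L * (indicator {a..b} t *\<^sub>R norm (v t)))"
      by (rule integral_mult_right_zero[symmetric])
    also have "\<dots> = (LINT t|unit_interval_measure. indicator {a..b} t *\<^sub>R (L * norm (v t)))"
      by (simp add: mult.left_commute)
    finally show ?thesis .
  qed
  moreover have "integrable unit_interval_measure (\<lambda>t. L * norm (v t))" using v by simp
  ultimately obtain z where z: "integrable unit_interval_measure z"
    "AE x in unit_interval_measure. \<bar>z x\<bar> \<le> L * norm (v x)"
    "\<forall>x\<in>{0..1}. w x = w 0 + primitive z x"
    using dominated_increments_imp_primitive[of "\<lambda>t. L * norm (v t)" w] by blast
  have "has_weak_deriv (\<phi> \<circ> u) z"
  proof (rule has_weak_deriv_primitive[OF z(1)])
    have "\<phi> \<in> borel_measurable borel"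
      using Lip by (intro borel_measurable_continuous_onI lipschitz_on_continuous_on)
    then show "\<phi> \<circ> u \<in> borel_measurable unit_interval_measure" using u by (rule measurable_comp[rotated])
    show "AE x in unit_interval_measure. (\<phi> \<circ> u) x = w 0 + primitive z x"
      using eq AE_space
    proof eventually_elim
      case (elim x)
      then have "(\<phi> \<circ> u) x = w x" by (simp add: w_def)
      also have "w x = w 0 + primitive z x" using elim(2) by (intro bspec[OF z(3)]) simp
      finally show ?case .
    qed
  qed
  moreover have "\<forall>x\<in>{0..1}. \<phi> (c + primitive v x) = \<phi> c + primitive z x"
    using z(3) unfolding w_def by (simp only: primitive_eq_0[OF order_refl] add_0_right)
  ultimately show ?thesis using z(1,2) by blast
qed

lemma Lipschitz_superposition:
  fixes \<phi> :: "'a::euclidean_space \<Rightarrow> real"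
  assumes Lip: "L-lipschitz_on UNIV \<phi>" and K: "\<And>y. \<bar>\<phi> y\<bar> \<le> K" and p: "1 \<le> p"
    and u: "u \<in> sobolev_space p"
  shows "\<phi> \<circ> u \<in> sobolev_space p"
    and "sobolev_norm p (\<phi> \<circ> u) \<le> K + L * Lp_norm p (weak_deriv u)"
proof -
  obtain v where v: "v \<in> Lp_space p" "has_weak_deriv u v" using u by (auto simp: sobolev_space_def)
  have uLp: "u \<in> Lp_space p" using u by (simp add: sobolev_space_def)
  have L: "0 \<le> L" using Lip by (rule lipschitz_on_nonneg)
  have um: "u \<in> borel_measurable unit_interval_measure" using uLp by (simp add: Lp_space_def)
  obtain c where c: "AE x in unit_interval_measure. u x = c + primitive v x"
    using has_weak_deriv_imp_primitive[OF _ _ v(2)] Lp_space_imp_integrable p uLp v(1) by blast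
  obtain z where z: "integrable unit_interval_measure z" "has_weak_deriv (\<phi> \<circ> u) z"
    "AE x in unit_interval_measure. \<bar>z x\<bar> \<le> L * norm (v x)"
    using Lipschitz_chain_rule[OF Lip um Lp_space_imp_integrable[OF v(1) p] c] by blast
  have zLp: "z \<in> Lp_space p" "Lp_norm p z \<le> L * Lp_norm p v"
    using z by (auto intro!: Lp_dominated[OF v(1) p L])
  have "\<phi> \<circ> u \<in> borel_measurable unit_interval_measure"
    using z(2) by (intro locally_integrable_measurable) (simp add: has_weak_deriv_def)
  moreover have "0 \<le> K" using order_trans[OF abs_ge_zero K] .
  moreover have "AE x in unit_interval_measure. norm ((\<phi> \<circ> u) x) \<le> K * norm (1::real)"
    using K by (intro AE_I2) simp
  ultimately have pLp: "\<phi> \<circ> u \<in> Lp_space p" "Lp_norm p (\<phi> \<circ> u) \<le> K * Lp_norm p (\<lambda>x. 1::real)"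
    using Lp_dominated[OF const_in_Lp_space(1)[OF p] p] by blast+
  show "\<phi> \<circ> u \<in> sobolev_space p" using pLp zLp z by (auto simp: sobolev_space_def)
  show "sobolev_norm p (\<phi> \<circ> u) \<le> K + L * Lp_norm p (weak_deriv u)"
    using pLp(2) zLp(2) const_in_Lp_space(2)[OF p, of "1::real"]
      Lp_norm_weak_deriv[OF z(2), of p] Lp_norm_weak_deriv[OF v(2), of p]
    by (simp add: sobolev_norm_def)
qed

lemma Lipschitz_superposition_bounded_operator:
  fixes \<phi> :: "'a::euclidean_space \<Rightarrow> real"
  assumes Lip: "L-lipschitz_on UNIV \<phi>" and K: "\<And>y. \<bar>\<phi> y\<bar> \<le> K" and p: "1 \<le> p"
  shows "sobolev_bounded_operator p (\<lambda>u. \<phi> \<circ> u)"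
  unfolding sobolev_bounded_operator_def sobolev_operator_def
proof (intro conjI ballI allI impI)
  show "\<phi> \<circ> u \<in> sobolev_space p" if "u \<in> sobolev_space p" for u
    by (rule Lipschitz_superposition(1)[OF Lip K p that])
  show "AE x in unit_interval_measure. (\<phi> \<circ> u) x = (\<phi> \<circ> v) x"
    if "AE x in unit_interval_measure. u x = v x" for u v
    using that by eventually_elim simp
  fix A :: "(real \<Rightarrow> 'a) set"
  assume A: "A \<subseteq> sobolev_space p" and "bdd_above (sobolev_norm p ` A)"
  then obtain B where B: "\<And>u. u \<in> A \<Longrightarrow> sobolev_norm p u \<le> B" by (auto simp: bdd_above_def)
  have "sobolev_norm p (\<phi> \<circ> u) \<le> K + L * B" if "u \<in> A" for u
  proof -
    have "Lp_norm p (weak_deriv u) \<le> B"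
      using B[OF that] Lp_norm_nonneg[of p u] by (simp add: sobolev_norm_def)
    then have "L * Lp_norm p (weak_deriv u) \<le> L * B"
      using lipschitz_on_nonneg[OF Lip] by (intro mult_left_mono)
    then show ?thesis using Lipschitz_superposition(2)[OF Lip K p, of u] A that by auto
  qed
  then show "bdd_above (sobolev_norm p ` (\<lambda>u. \<phi> \<circ> u) ` A)" by (auto simp: bdd_above_def)
qed

section \<open>A Lipschitz function with an oscillating composition\<close>

lemma lipschitz_on_infdist: "1-lipschitz_on UNIV (\<lambda>y. infdist y S)"
  by (intro lipschitz_onI) (auto simp: dist_real_def infdist_triangle_abs)

definition horizontal :: "real \<Rightarrow> real \<Rightarrow> real ^ 2" where
  "horizontal h x = h *\<^sub>R axis 2 1 + x *\<^sub>R axis 1 1"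

lemma horizontal_nth [simp]: "horizontal h x $ 1 = x" "horizontal h x $ 2 = h"
  by (simp_all add: horizontal_def axis_def)

text \<open>
  The set whose distance function is the counterexample: everything outside an open box, together
  with grids on the lines at height \<open>2\<^sup>-\<^sup>n\<close> whose spacing equals the height. The box contains the
  unit interval at each of these heights with room to spare, and its lower edge is the limit line.
\<close>

definition zero_set :: "(real ^ 2) set" where
  "zero_set = {y. \<not> (-1 < y $ 1 \<and> y $ 1 < 2 \<and> 0 < y $ 2 \<and> y $ 2 < 2)} \<union>
     {horizontal (1 / 2 ^ n) (of_int k / 2 ^ n) | n k. True}"

lemma horizontal_sobolev:
  assumes "1 \<le> p"
  shows "horizontal h \<in> sobolev_space p"
    and "horizontal h \<in> borel_measurable unit_interval_measure"
    and "AE x in unit_interval_measure. horizontal h x = horizontal h 0 + primitive (\<lambda>_. axis 1 1) x"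
proof -
  interpret finite_measure unit_interval_measure by (rule finite_unit_interval_measure)
  show m: "horizontal h \<in> borel_measurable unit_interval_measure"
    unfolding horizontal_def by (intro borel_measurable_unit_interval) simp
  show eq: "AE x in unit_interval_measure. horizontal h x = horizontal h 0 + primitive (\<lambda>_. axis 1 1) x"
    using AE_space by eventually_elim (simp add: primitive_const horizontal_def)
  have "has_weak_deriv (horizontal h) (\<lambda>_. axis 1 1)"
    using m eq by (intro has_weak_deriv_primitive) auto
  moreover have "horizontal h \<in> Lp_space p"
  proof (rule Lp_dominated(1)[OF const_in_Lp_space(1)[OF assms] assms])
    show "AE x in unit_interval_measure. norm (horizontal h x) \<le> (\<bar>h\<bar> + 1) * norm (1::real)"
      using AE_space
    proof eventually_elim
      case (elim x)
      have "norm (horizontal h x) \<le> norm (h *\<^sub>R (axis 2 1 :: real ^ 2)) + norm (x *\<^sub>R (axis 1 1 :: real ^ 2))"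
        unfolding horizontal_def by (rule norm_triangle_ineq)
      then show ?case using elim by (simp add: norm_axis_1)
    qed
  qed (use m in auto)
  ultimately show "horizontal h \<in> sobolev_space p"
    using const_in_Lp_space(1)[OF assms] by (auto simp: sobolev_space_def)
qed

text \<open>
  Midway between two neighbouring grid points on the line at height \<open>e = 2\<^sup>-\<^sup>n\<close>, the grid on the same
  line is horizontally at distance at least \<open>e / 2\<close>, and every other grid line is vertically at least
  as far away, the nearest being the one at height \<open>e / 2\<close>. The complement of the box is even farther.
\<close>

lemma infdist_zero_set_peak:
  assumes k: "k < 2 ^ n"
  shows "1 / 2 ^ n / 2 \<le> infdist (horizontal (1 / 2 ^ n) ((real k + 1 / 2) / 2 ^ n)) zero_set"
proof -
  define e :: real where "e = 1 / 2 ^ n"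
  define s where "s = (real k + 1 / 2) * e"
  define y where "y = horizontal e s"
  have e: "0 < e" "e \<le> 1" by (auto simp: e_def)
  have "real k + 1 \<le> 2 ^ n" using k by (metis Suc_leI of_nat_Suc of_nat_le_iff of_nat_numeral of_nat_power add.commute)
  then have "(real k + 1) * e \<le> 2 ^ n * e" using e by (intro mult_right_mono) auto
  also have "2 ^ n * e = 1" by (simp add: e_def)
  finally have ke: "(real k + 1) * e \<le> 1" .
  have s: "0 \<le> s" "s \<le> 1"
    using e ke by (auto simp: s_def algebra_simps)
  have comp: "\<bar>y $ i - a $ i\<bar> \<le> dist y a" for a i
    using component_le_norm_cart[of "y - a" i] by (simp add: dist_norm)
  have "e / 2 \<le> dist y a" if a: "a \<in> zero_set" for a
  proof -
    \<comment> \<open>It suffices that one coordinate differs by \<open>e / 2\<close>.\<close>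
    have "e / 2 \<le> \<bar>y $ 1 - a $ 1\<bar> \<or> e / 2 \<le> \<bar>y $ 2 - a $ 2\<bar>"
    proof (cases "-1 < a $ 1 \<and> a $ 1 < 2 \<and> 0 < a $ 2 \<and> a $ 2 < 2")
      case False
      then show ?thesis using s e by (auto simp: y_def)
    next
      case True
      then obtain m j where a: "a = horizontal (1 / 2 ^ m) (of_int j / 2 ^ m)"
        using a by (auto simp: zero_set_def)
      define M :: real where "M = 1 / 2 ^ m"
      consider "m = n" | "m < n" | "n < m" by linarith
      then show ?thesis
      proof cases
        case 1
        have "1 / 2 \<le> \<bar>real k + 1 / 2 - of_int j\<bar>"
        proof (cases "int k < j")
          case True
          then have "real k + 1 \<le> of_int j" by linarith
          then show ?thesis by simp
        next
          case False
          then have "of_int j \<le> real k" by linarith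
          then show ?thesis by simp
        qed
        then have "1 / 2 * e \<le> \<bar>real k + 1 / 2 - of_int j\<bar> * e" using e by (intro mult_right_mono) auto
        also have "\<dots> = \<bar>(real k + 1 / 2 - of_int j) * e\<bar>" using e by (simp add: abs_mult)
        also have "(real k + 1 / 2 - of_int j) * e = y $ 1 - a $ 1"
          using 1 by (simp add: y_def s_def a e_def algebra_simps)
        finally show ?thesis by simp
      next
        case 2
        then have "(1 / 2 :: real) ^ n \<le> (1 / 2) ^ Suc m" by (intro power_decreasing) auto
        then have "e \<le> M / 2" by (simp add: e_def M_def power_one_over)
        then have "e / 2 \<le> \<bar>e - M\<bar>" using e by linarith
        then show ?thesis by (simp add: y_def a M_def)
      next
        case 3
        then have "(1 / 2 :: real) ^ m \<le> (1 / 2) ^ Suc n" by (intro power_decreasing) auto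
        then have "M \<le> e / 2" by (simp add: e_def M_def power_one_over)
        then have "e / 2 \<le> \<bar>e - M\<bar>" using e by linarith
        then show ?thesis by (simp add: y_def a M_def)
      qed
    qed
    then show ?thesis using comp[of 1 a] comp[of 2 a] by linarith
  qed
  have ne: "zero_set \<noteq> {}" by (auto simp: zero_set_def)
  then have "e / 2 \<le> (INF a\<in>zero_set. dist y a)"
    using \<open>\<And>a. a \<in> zero_set \<Longrightarrow> e / 2 \<le> dist y a\<close> by (rule cINF_greatest)
  then have "e / 2 \<le> infdist y zero_set" using ne by (simp add: infdist_notempty)
  then show ?thesis by (simp add: y_def s_def e_def)
qed

text \<open>
  At the curve \<open>horizontal 0\<close>, the tolerance 1/4 is never met: each \<open>horizontal (2\<^sup>-\<^sup>n)\<close> is mapped to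
  a function of total variation at least 1/2, so that the \<open>L\<^sup>p\<close> norm of its weak derivative is at
  least 1/4.
\<close>

lemma infdist_zero_set_not_continuous:
  assumes p: "1 \<le> p"
  shows "\<not> sobolev_continuous_operator p (\<lambda>u. (\<lambda>y. infdist y zero_set) \<circ> u)"
proof
  let ?\<phi> = "\<lambda>y. infdist y zero_set"
  interpret finite_measure unit_interval_measure by (rule finite_unit_interval_measure)
  assume "sobolev_continuous_operator p (\<lambda>u. ?\<phi> \<circ> u)"
  from this[unfolded sobolev_continuous_operator_def, rule_format, OF horizontal_sobolev(1)[OF p, of 0], of "1/4"]
  obtain \<delta> where \<delta>: "\<delta> > 0" "\<forall>v\<in>sobolev_space p. sobolev_norm p (\<lambda>x. v x - horizontal 0 x) < \<delta> \<longrightarrow>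
        sobolev_norm p (\<lambda>x. (?\<phi> \<circ> v) x - (?\<phi> \<circ> horizontal 0) x) < 1/4" by auto
  obtain n where n: "(1 / 2 :: real) ^ n < \<delta>" using real_arch_pow_inv[OF \<delta>(1), of "1/2"] by auto
  define e :: real where "e = 1 / 2 ^ n"
  have e: "0 < e" "e < \<delta>" using n by (auto simp: e_def power_one_over)
  have "sobolev_norm p (\<lambda>x. horizontal e x - horizontal 0 x) = e"
  proof -
    have eq: "(\<lambda>x. horizontal e x - horizontal 0 x) = (\<lambda>x. e *\<^sub>R axis 2 1)"
      by (auto simp: horizontal_def)
    have "has_weak_deriv (\<lambda>x. e *\<^sub>R axis 2 1 :: real ^ 2) (\<lambda>x. 0)"
      by (rule has_weak_deriv_primitive[where c="e *\<^sub>R axis 2 1"]) (simp_all add: primitive_def)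
    from Lp_norm_weak_deriv[OF this, of p]
    show ?thesis
      unfolding eq using e const_in_Lp_space(2)[OF p, of "e *\<^sub>R axis 2 1 :: real ^ 2"]
        const_in_Lp_space(2)[OF p, of "0 :: real ^ 2"] by (simp add: sobolev_norm_def norm_axis_1)
  qed
  with \<delta>(2) e horizontal_sobolev(1)[OF p, of e]
  have "sobolev_norm p (\<lambda>x. (?\<phi> \<circ> horizontal e) x - (?\<phi> \<circ> horizontal 0) x) < 1/4" by auto
  moreover have "?\<phi> (horizontal 0 x) = 0" for x
    by (intro infdist_zero) (simp add: zero_set_def)
  ultimately have small: "sobolev_norm p (?\<phi> \<circ> horizontal e) < 1/4" by (simp add: comp_def)
  have Lip: "1-lipschitz_on UNIV ?\<phi>"
    by (rule lipschitz_on_infdist)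
  obtain z where z: "integrable unit_interval_measure z" "has_weak_deriv (?\<phi> \<circ> horizontal e) z"
    "AE x in unit_interval_measure. \<bar>z x\<bar> \<le> 1 * norm (axis 1 1 :: real ^ 2)"
    "\<forall>x\<in>{0..1}. ?\<phi> (horizontal e 0 + primitive (\<lambda>_. axis 1 1) x) = ?\<phi> (horizontal e 0) + primitive z x"
    using Lipschitz_chain_rule[OF Lip horizontal_sobolev(2)[OF p] _ horizontal_sobolev(3)[OF p], of e]
    by auto
  have zp: "z \<in> Lp_space p"
    using Lp_dominated(1)[OF const_in_Lp_space(1)[OF p] p, of 1 z "axis 1 1 :: real ^ 2"] z(1,3) by simp
  have prim: "?\<phi> (horizontal e x) = ?\<phi> (horizontal e 0) + primitive z x" if "x \<in> {0..1}" for x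
  proof -
    have "horizontal e 0 + primitive (\<lambda>_. axis 1 1) x = horizontal e x"
      using that by (simp add: primitive_const horizontal_def)
    with bspec[OF z(4) that] show ?thesis by simp
  qed
  define V where "V = primitive (\<lambda>t. norm (z t))"
  have V: "\<bar>primitive z b - primitive z a\<bar> \<le> V b - V a" if "a \<le> b" for a b
    using norm_primitive_diff_le[OF z(1) that] by (simp add: V_def)
  \<comment> \<open>Only the rising half of each tooth is counted; \<open>V\<close> does not decrease on the other half.\<close>
  have variation: "real k * e / 2 \<le> V (real k * e)" if "k \<le> 2 ^ n" for k
    using that
  proof (induction k)
    case 0
    then show ?case by (simp add: V_def primitive_eq_0)
  next
    case (Suc k)
    define a b c where "a = real k * e" and "b = (real k + 1 / 2) * e" and "c = real (Suc k) * e"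
    have "real (Suc k) \<le> 2 ^ n" using Suc.prems by (metis of_nat_le_iff of_nat_numeral of_nat_power)
    then have "c \<le> 2 ^ n * e" unfolding c_def using e by (intro mult_right_mono) auto
    then have abc: "0 \<le> a" "a \<le> b" "b \<le> c" "c \<le> 1" using e(1)
      by (auto simp: a_def b_def c_def e_def field_simps)
    have "horizontal e a \<in> zero_set"
      unfolding zero_set_def by (rule UnI2) (auto simp: a_def e_def intro!: exI[of _ n] exI[of _ "int k"])
    then have "?\<phi> (horizontal e a) = 0" by (rule infdist_zero)
    moreover have "e / 2 \<le> ?\<phi> (horizontal e b)"
      using infdist_zero_set_peak[of k n] Suc.prems by (simp add: e_def b_def)
    ultimately have "e / 2 \<le> primitive z b - primitive z a"
      using prim[of a] prim[of b] abc by auto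
    also have "\<dots> \<le> V b - V a" using V[OF abc(2)] by linarith
    also have "\<dots> \<le> V c - V a" using V[OF abc(3)] by linarith
    finally have "e / 2 + V a \<le> V c" by simp
    then show ?case using Suc.IH Suc.prems by (simp add: a_def c_def algebra_simps add_divide_distrib)
  qed
  have "2 * (1/4) \<le> (LINT x|unit_interval_measure. norm (z x))"
  proof -
    have "V 1 = (LINT x|unit_interval_measure. norm (z x))"
      unfolding V_def primitive_def by (intro Bochner_Integration.integral_cong) (auto simp: indicator_def)
    moreover have "1/2 \<le> V 1" using variation[of "2 ^ n"] by (simp add: e_def)
    ultimately show ?thesis by simp
  qed
  then have "1/4 \<le> Lp_norm p z" using zp p by (intro Lp_norm_ge_half_mean) auto
  also have "\<dots> \<le> sobolev_norm p (?\<phi> \<circ> horizontal e)"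
    using Lp_norm_weak_deriv[OF z(2), of p] Lp_norm_nonneg by (simp add: sobolev_norm_def)
  finally show False using small by simp
qed

theorem theorem1p2:
  "\<exists>\<phi> :: real ^ 2 \<Rightarrow> real.
     (\<exists>L. L-lipschitz_on UNIV \<phi>) \<and>
     compact (closure {y. \<phi> y \<noteq> 0}) \<and>
     (\<forall>p \<ge> 1.
        sobolev_bounded_operator p (\<lambda>u. \<phi> \<circ> u) \<and>
        \<not> sobolev_continuous_operator p (\<lambda>u. \<phi> \<circ> u))"
proof -
  define \<phi> :: "real ^ 2 \<Rightarrow> real" where "\<phi> = (\<lambda>y. infdist y zero_set)"
  have Lip: "1-lipschitz_on UNIV \<phi>"
    unfolding \<phi>_def by (rule lipschitz_on_infdist)
  have bound: "\<bar>\<phi> y\<bar> \<le> 2" for y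
  proof (cases "y \<in> zero_set")
    case True
    then show ?thesis by (simp add: \<phi>_def)
  next
    case False
    have "horizontal 0 (y $ 1) \<in> zero_set" by (simp add: zero_set_def)
    then have "\<phi> y \<le> dist y (horizontal 0 (y $ 1))" unfolding \<phi>_def by (rule infdist_le)
    also have "\<dots> \<le> (\<Sum>i\<in>UNIV. \<bar>(y - horizontal 0 (y $ 1)) $ i\<bar>)"
      unfolding dist_norm by (rule norm_le_l1_cart)
    also have "\<dots> = \<bar>y $ 2\<bar>" by (simp add: sum_2)
    also have "\<dots> \<le> 2" using False by (auto simp: zero_set_def)
    finally show ?thesis by (simp add: \<phi>_def infdist_nonneg)
  qed
  have "{y. \<phi> y \<noteq> 0} \<subseteq> cball 0 4"
  proof
    fix y assume "y \<in> {y. \<phi> y \<noteq> 0}"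
    then have "y \<notin> zero_set" by (auto simp: \<phi>_def)
    then have "\<bar>y $ 1\<bar> + \<bar>y $ 2\<bar> \<le> 4" by (auto simp: zero_set_def)
    then show "y \<in> cball 0 4" using norm_le_l1_cart[of y] by (simp add: sum_2)
  qed
  then have "bounded {y. \<phi> y \<noteq> 0}" using bounded_cball bounded_subset by blast
  then have "compact (closure {y. \<phi> y \<noteq> 0})" by simp
  moreover have "sobolev_bounded_operator p (\<lambda>u. \<phi> \<circ> u)" if "1 \<le> p" for p
    using Lipschitz_superposition_bounded_operator[OF Lip bound that] .
  moreover have "\<not> sobolev_continuous_operator p (\<lambda>u. \<phi> \<circ> u)" if "1 \<le> p" for p
    unfolding \<phi>_def using infdist_zero_set_not_continuous[OF that] .
  ultimately show ?thesis using Lip by blast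
qed

end
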